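(* Let $\nu_0=1$ and let $\nu_1,\nu_2,\ldots\in\mathbb N$ be fixed. Let $K^{\mathscr G}_{n,\vec\nu}$ be the extended Ginibre product-matrix kernel and $K^{\mathscr H}_{\vec\nu}$ the extended hard-edge kernel (both defined in the context). Then for every $q,r\in\mathbb N$, $$\frac1n\,K^{\mathscr G}_{n,\vec\nu}\left(q,\frac xn;r,\frac yn\right)\xrightarrow[n\to\infty]{}K^{\mathscr H}_{\vec\nu}(q,x;r,y)$$ uniformly for $x,y$ in compact subsets of $(0,\infty)$.
   Context: For $x,y>0$ and $q,r\in\mathbb N$ the extended Ginibre product-matrix kernel is $$K^{\mathscr G}_{n,\vec\nu}(q,x;r,y)=-\frac{1_{r>q}}{x}G^{r-q,0}_{0,r-q}\!\left(\begin{matrix}-\\ \nu_{q+1}-1,\ldots,\nu_r-1\end{matrix}\Big|\frac yx\right)+\int_{S_\sigma}\frac{d\sigma}{2\pi i}\int_{S_\zeta^{(n)}}\frac{d\zeta}{2\pi i}\frac{\prod_{j=0}^r\Gamma(\sigma+\nu_j)}{\prod_{j=0}^q\Gamma(\zeta+\nu_j)}\frac{\Gamma(\zeta-n+1)}{\Gamma(\sigma-n+1)}\frac{x^\zeta y^{-\sigma-1}}{\sigma-\zeta}.$$ (It is the correlation kernel of the determinantal point process on $\mathbb N\times(0,\infty)$ formed by the pairs $(k,\lambda)$, with $\lambda$ a squared singular value of $G_k\cdots G_1$, where the $G_k$ are independent complex Ginibre matrices of size $(n+\nu_k-1)\times(n+\nu_{k-1}-1)$.) The extended hard-edge kernel is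 $$K^{\mathscr H}_{\vec\nu}(q,x;r,y)=-\frac{1_{r>q}}{x}G^{r-q,0}_{0,r-q}\!\left(\begin{matrix}-\\ \nu_{q+1}-1,\ldots,\nu_r-1\end{matrix}\Big|\frac yx\right)+\int_{S_\sigma}\frac{d\sigma}{2\pi i}\int_{S_\zeta}\frac{d\zeta}{2\pi i}\frac{\prod_{j=1}^r\Gamma(\sigma+\nu_j)}{\prod_{j=1}^q\Gamma(\zeta+\nu_j)}\frac{\Gamma(-\zeta)}{\Gamma(-\sigma)}\frac{x^\zeta y^{-\sigma-1}}{\sigma-\zeta}.$$ Meijer function: $G^{p,0}_{0,p}\!\left(\begin{matrix}-\\ b_1,\ldots,b_p\end{matrix}\Big|z\right)=\frac1{2\pi i}\int_\gamma\prod_{j=1}^p\Gamma(b_j+\eta)\,z^{-\eta}\,d\eta$, $z>0$, with $\gamma$ an upward vertical line to the right of all poles of the integrand. Contours: $S_\sigma$ comes from $-\infty-i\delta$ horizontally to $-c-i\delta$, goes up to $-c+i\delta$, and returns horizontally to $-\infty+i\delta$ ($\delta>0$, $0<c<1$), encircling $-1,-2,\ldots$ counterclockwise. $S_\zeta^{(n)}$ is a closed counterclockwise rectangular contour enclosing $0,1,\ldots,n-1$ and no other integers. $S_\zeta$ comes from $+\infty+i\delta$ horizontally to $-c'+i\delta$, goes down to $-c'-i\delta$, and then horizontally to $+\infty-i\delta$ ($0<c'<c$), encircling $0,1,2,\ldots$ counterclockwise. Both $S_\zeta$ and $S_\zeta^{(n)}$ lie to the right of, and do not intersect, $S_\sigma$.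 *)

theory Defs
  imports "HOL-Complex_Analysis.Complex_Analysis"
begin

text \<open>
  The line of integration is \<open>{\<eta>. Re \<eta> = \<kappa>}\<close>, traversed upwards. It lies to the right of all
  poles of the integrand iff \<open>- Re b < \<kappa>\<close> for all \<open>b\<close> in \<open>bs\<close>. The length of \<open>bs\<close> is the upper
  left index \<open>p\<close>.
\<close>
definition meijer_G :: "real \<Rightarrow> complex list \<Rightarrow> real \<Rightarrow> complex" where
  "meijer_G \<kappa> bs z =
     1 / (2 * of_real pi * \<i>) *
     (LINT t|lborel. (let \<eta> = Complex \<kappa> t in
        (\<Prod>b\<leftarrow>bs. Gamma (b + \<eta>)) * of_real z powr (- \<eta>) * \<i>))"

text \<open>Integral along the half-line from \<open>a\<close> to infinity in direction \<open>d\<close>.\<close>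
definition ray_integral :: "complex \<Rightarrow> complex \<Rightarrow> (complex \<Rightarrow> complex) \<Rightarrow> complex" where
  "ray_integral a d f = (LINT t:{0..}|lborel. f (a + of_real t * d) * d)"

text \<open>
  Integral along the contour coming from infinity (in direction \<open>d\<close>) to \<open>a\<close>, then straight to \<open>b\<close>,
  and from \<open>b\<close> back to infinity in direction \<open>d\<close>.
\<close>
definition hook_integral ::
  "complex \<Rightarrow> complex \<Rightarrow> complex \<Rightarrow> (complex \<Rightarrow> complex) \<Rightarrow> complex" where
  "hook_integral d a b f =
     - ray_integral a d f + contour_integral (linepath a b) f + ray_integral b d f"

definition S_sigma_integral :: "real \<Rightarrow> real \<Rightarrow> (complex \<Rightarrow> complex) \<Rightarrow> complex" where
  "S_sigma_integral c \<delta> = hook_integral (-1) (Complex (-c) (-\<delta>)) (Complex (-c) \<delta>)"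

definition S_zeta_integral :: "real \<Rightarrow> real \<Rightarrow> (complex \<Rightarrow> complex) \<Rightarrow> complex" where
  "S_zeta_integral c' \<delta> = hook_integral 1 (Complex (-c') \<delta>) (Complex (-c') (-\<delta>))"

text \<open>
  The rectangle with lower left corner \<open>a\<close> and upper right corner \<open>b\<close>, together with the
  half-strip contour \<open>S_sigma\<close>. Since \<open>c < 1\<close>, the integers enclosed are exactly
  \<open>0, \<dots>, n - 1\<close>, and the rectangle lies in the half-plane to the right of \<open>S_sigma\<close>.
\<close>
definition S_zeta_rectangle :: "real \<Rightarrow> nat \<Rightarrow> complex \<Rightarrow> complex \<Rightarrow> bool" where
  "S_zeta_rectangle c n a b \<longleftrightarrow>
     - c < Re a \<and> Re a < 0 \<and> real n - 1 < Re b \<and> Re b < real n \<and> Im a < 0 \<and> 0 < Im b"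

text \<open>The term without contour integrals that is common to both kernels.\<close>
definition kernel_transition ::
  "real \<Rightarrow> (nat \<Rightarrow> nat) \<Rightarrow> nat \<Rightarrow> real \<Rightarrow> nat \<Rightarrow> real \<Rightarrow> complex" where
  "kernel_transition \<kappa> \<nu> q x r y =
     (if r > q then
        - 1 / of_real x * meijer_G \<kappa> (map (\<lambda>j. of_nat (\<nu> j) - 1) [q + 1..<r + 1]) (y / x)
      else 0)"

text \<open>
  The arguments \<open>\<kappa>\<close>, \<open>c\<close>, \<open>\<delta>\<close>, \<open>c'\<close>, \<open>a\<close>, \<open>b\<close> below describe the contours; \<open>a\<close> and \<open>b\<close> are the
  corners of the rectangle.
\<close>
definition ginibre_kernel ::
  "real \<Rightarrow> real \<Rightarrow> real \<Rightarrow> complex \<Rightarrow> complex \<Rightarrow>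
   nat \<Rightarrow> (nat \<Rightarrow> nat) \<Rightarrow> nat \<Rightarrow> real \<Rightarrow> nat \<Rightarrow> real \<Rightarrow> complex" where
  "ginibre_kernel \<kappa> c \<delta> a b n \<nu> q x r y =
     kernel_transition \<kappa> \<nu> q x r y +
     S_sigma_integral c \<delta> (\<lambda>\<sigma>.
       contour_integral (rectpath a b) (\<lambda>\<zeta>.
         (\<Prod>j=0..r. Gamma (\<sigma> + of_nat (\<nu> j))) / (\<Prod>j=0..q. Gamma (\<zeta> + of_nat (\<nu> j))) *
         (Gamma (\<zeta> - of_nat n + 1) / Gamma (\<sigma> - of_nat n + 1)) *
         (of_real x powr \<zeta> * of_real y powr (- \<sigma> - 1) / (\<sigma> - \<zeta>)))
       / (2 * of_real pi * \<i>))
     / (2 * of_real pi * \<i>)"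

definition hard_edge_kernel ::
  "real \<Rightarrow> real \<Rightarrow> real \<Rightarrow> real \<Rightarrow>
   (nat \<Rightarrow> nat) \<Rightarrow> nat \<Rightarrow> real \<Rightarrow> nat \<Rightarrow> real \<Rightarrow> complex" where
  "hard_edge_kernel \<kappa> c \<delta> c' \<nu> q x r y =
     kernel_transition \<kappa> \<nu> q x r y +
     S_sigma_integral c \<delta> (\<lambda>\<sigma>.
       S_zeta_integral c' \<delta> (\<lambda>\<zeta>.
         (\<Prod>j=1..r. Gamma (\<sigma> + of_nat (\<nu> j))) / (\<Prod>j=1..q. Gamma (\<zeta> + of_nat (\<nu> j))) *
         (Gamma (- \<zeta>) / Gamma (- \<sigma>)) *
         (of_real x powr \<zeta> * of_real y powr (- \<sigma> - 1) / (\<sigma> - \<zeta>)))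
       / (2 * of_real pi * \<i>))
     / (2 * of_real pi * \<i>)"

end

theory Submission
  imports Defs
begin

text \<open>
  The \<open>\<zeta>\<close>-integrals of both kernels are evaluated by residues, which removes the contours that depend
  on \<open>n\<close>. Because \<open>\<nu> 0 = 1\<close>, the integrand of the finite kernel contains
  \<open>\<Gamma>(\<zeta> - n + 1) / \<Gamma>(\<zeta> + 1)\<close>, which has simple poles exactly at \<open>0, \<dots>, n - 1\<close>, whereas the
  integrand of the limit kernel contains \<open>\<Gamma>(- \<zeta>)\<close>, with simple poles at all \<open>k \<ge> 0\<close>. After
  rescaling, the residue at \<open>k\<close> of the former is that of the latter times
  \<open>(n - 1) \<dots> (n - k) / n\<^bsup>k\<^esup>\<close>, a number in \<open>[0, 1]\<close> tending to \<open>1\<close>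
  (\<open>ginibre_inner_integral\<close>, \<open>hard_edge_inner_integral\<close>).
  
  The remaining factor \<open>\<Gamma>(\<sigma> + 1) / \<Gamma>(\<sigma> - n + 1)\<close> is a polynomial in \<open>\<sigma>\<close> which, after
  rescaling, is Euler's product for \<open>1 / \<Gamma>(- \<sigma>)\<close>. So the integrands in \<open>\<sigma>\<close> converge pointwise, and
  what is left is dominated convergence along the unbounded contour \<open>S_sigma\<close>, uniformly in \<open>x\<close> and
  \<open>y\<close> (\<open>S_sigma_integral_uniform_limit\<close>). There are two ingredients. Euler's products are bounded by
  \<open>\<bar>\<sigma>\<bar> exp (2 (- Re \<sigma> + (Im \<sigma>)\<^sup>2))\<close> for all \<open>n\<close> (\<open>norm_rGamma_quotient_le\<close>), so that they and the
  power of \<open>y\<close> grow at most exponentially. On the horizontal parts of the contour the factor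
  \<open>\<Gamma>(\<sigma> + \<nu> 1)\<close>, present because \<open>r \<ge> 1\<close>, decays faster than every exponential
  (\<open>rGamma_strip_decay\<close> together with the reflection formula). The same decay lets the residue theorem
  be applied to the half-strip contour of the limit kernel (\<open>S_zeta_integral_sums_residues\<close>).
\<close>

section \<open>Estimates for the Gamma function\<close>

text \<open>
  In a strip \<open>1 / \<Gamma>\<close> decays faster than every exponential: the weighted function
  \<open>\<bar>1 / \<Gamma>(z)\<bar> K\<^bsup>Re z\<^esup>\<close> is bounded on a compact rectangle reaching to \<open>Re z = K + 1\<close>, and beyond it a
  unit step to the right cannot increase it, because \<open>1 / \<Gamma>(z + 1) = 1 / (z \<Gamma>(z))\<close> and \<open>\<bar>z\<bar> \<ge> K\<close>.
\<close>
lemma rGamma_strip_decay: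
  fixes d A K :: real
  assumes K: "K > 0" and A: "A \<ge> 0"
  shows "\<exists>C>0. \<forall>z::complex. \<bar>Im z\<bar> \<le> d \<longrightarrow> - A \<le> Re z \<longrightarrow> norm (rGamma z) \<le> C * K powr (- Re z)"
proof -
  define \<phi> where "\<phi> = (\<lambda>z::complex. norm (rGamma z) * K powr Re z)"
  define S where "S = cbox (Complex (- A) (- d)) (Complex (K + 1) d)"
  have "continuous_on S \<phi>"
    unfolding \<phi>_def using K by (intro continuous_intros) auto
  then have "compact (\<phi> ` S)"
    by (rule compact_continuous_image) (simp add: S_def)
  then obtain C where C: "C > 0" "\<And>z. z \<in> S \<Longrightarrow> norm (\<phi> z) \<le> C"
    using compact_imp_bounded bounded_pos by (metis imageI)
  have base: "\<phi> z \<le> C" if "\<bar>Im z\<bar> \<le> d" "- A \<le> Re z" "Re z \<le> K + 1" for z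
    using C(2)[of z] that by (auto simp: S_def in_cbox_complex_iff abs_le_iff)
  have bound: "\<phi> z \<le> C" if "\<bar>Im z\<bar> \<le> d" "- A \<le> Re z" "Re z \<le> K + 1 + real m" for m z
    using that
  proof (induction m arbitrary: z)
    case 0
    then show ?case using base by auto
  next
    case (Suc m)
    show ?case
    proof (cases "Re z \<le> K + 1")
      case True
      then show ?thesis using base Suc.prems by auto
    next
      case False
      define w where "w = z - 1"
      have w: "Re w > K" "z = w + 1" using False by (auto simp: w_def)
      have "\<phi> w \<le> C"
      proof (rule Suc.IH)
        show "\<bar>Im w\<bar> \<le> d" "Re w \<le> K + 1 + real m" using Suc.prems by (simp_all add: w_def)
        show "- A \<le> Re w" using w K A by linarith
      qed
      moreover have "\<phi> z \<le> \<phi> w"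
      proof -
        have "norm w \<ge> K" using w complex_Re_le_cmod[of w] by linarith
        have eq: "rGamma w = w * rGamma z" using rGamma_plus1[of w] w by simp
        have "K * norm (rGamma z) * K powr Re w \<le> norm w * norm (rGamma z) * K powr Re w"
          using \<open>norm w \<ge> K\<close> by (intro mult_right_mono) auto
        also have "\<dots> = \<phi> w"
          by (simp add: \<phi>_def eq norm_mult)
        finally show ?thesis
          using K by (simp add: \<phi>_def w powr_add mult_ac)
      qed
      ultimately show ?thesis by linarith
    qed
  qed
  have "norm (rGamma z) \<le> C * K powr (- Re z)" if "\<bar>Im z\<bar> \<le> d" "- A \<le> Re z" for z
  proof -
    obtain m where "Re z - (K + 1) \<le> real m" using real_arch_simple by blast
    then have "\<phi> z \<le> C" using bound[of z m] that by auto
    then show ?thesis using K by (simp add: \<phi>_def powr_minus field_simps)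
  qed
  with C(1) show ?thesis by blast
qed

text \<open>
  The reflection formula transfers the decay of \<open>1 / \<Gamma>\<close> on the right to \<open>\<Gamma>\<close> on the left, wherever
  \<open>\<bar>sin (\<pi> z)\<bar>\<close> is bounded below. The contours meet this condition in two ways: on their horizontal
  parts \<open>Im z\<close> is a non-zero constant, and the right edges of the rectangles that exhaust the half-strip
  around \<open>0, 1, 2, \<dots>\<close> are placed half-way between two integers.
\<close>
lemma norm_sin_ge_sinh_Im:
  fixes z :: complex
  shows "\<bar>sinh (Im z)\<bar> \<le> norm (sin z)"
proof -
  have "sinh (Im z) ^ 2 = (exp (2 * Im z) + inverse (exp (2 * Im z)) - 2) / 4"
    unfolding sinh_field_def exp_double exp_minus by (simp add: field_simps power2_eq_square)
  also have "\<dots> \<le> norm (sin z) ^ 2"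
    unfolding norm_sin_squared by (intro divide_right_mono) auto
  finally show ?thesis
    by (metis abs_le_square_iff abs_norm_cancel)
qed

lemma norm_sin_half_odd_ge_1:
  fixes z :: complex
  assumes "Re z = real n + 1/2"
  shows "1 \<le> norm (sin (of_real pi * z))"
proof -
  have "cos (2 * (pi * Re z)) = -1"
  proof -
    have "2 * (pi * Re z) = (2 * real n + 1) * pi" by (simp add: assms field_simps)
    then show ?thesis using cos_npi[of "2 * n + 1"] by (simp add: algebra_simps)
  qed
  moreover have "2 \<le> exp x + inverse (exp x)" for x :: real
    using cosh_real_ge_1[of x] by (simp add: cosh_field_def exp_minus)
  ultimately have "1 \<le> norm (sin (of_real pi * z)) ^ 2"
    by (simp add: norm_sin_squared)
  then have "1\<^sup>2 \<le> norm (sin (of_real pi * z)) ^ 2" by simp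
  then show ?thesis by (rule power2_le_imp_le) simp
qed

lemma Gamma_eq_rGamma_reflected:
  fixes z :: complex
  assumes "sin (of_real pi * z) \<noteq> 0"
  shows "Gamma z = of_real pi / sin (of_real pi * z) * rGamma (1 - z)"
proof -
  have refl: "Gamma z * Gamma (1 - z) = of_real pi / sin (of_real pi * z)"
    by (rule Gamma_reflection_complex)
  then have "Gamma (1 - z) \<noteq> 0" using assms by auto
  then have "Gamma z = Gamma z * Gamma (1 - z) * rGamma (1 - z)"
    by (simp add: rGamma_inverse_Gamma)
  then show ?thesis unfolding refl .
qed

text \<open>
  The constant does not depend on \<open>Re z\<close>, and \<open>K\<close> is arbitrary; so along a horizontal line going to the
  left a single Gamma factor outweighs any exponential growth of the other factors of the integrand.
\<close>
lemma Gamma_left_decay: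
  assumes K: "K > 0" and \<delta>: "\<delta> > 0"
  shows "\<exists>C>0. \<forall>z::complex. \<bar>Im z\<bar> = \<delta> \<longrightarrow> Re z \<le> B \<longrightarrow> norm (Gamma z) \<le> C * K powr Re z"
proof -
  obtain C where C: "C > 0" "\<And>z::complex. \<bar>Im z\<bar> \<le> \<delta> \<Longrightarrow> - max 0 (B - 1) \<le> Re z \<Longrightarrow>
      norm (rGamma z) \<le> C * K powr (- Re z)"
    using rGamma_strip_decay[OF K, of "max 0 (B - 1)" \<delta>] by auto
  define s where "s = sinh (pi * \<delta>)"
  have s: "s > 0" using \<delta> by (simp add: s_def)
  have "norm (Gamma z) \<le> (pi / s * C / K) * K powr Re z" if z: "\<bar>Im z\<bar> = \<delta>" "Re z \<le> B" for z :: complex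
  proof -
    have "sinh \<bar>pi * Im z\<bar> = s"
      using z by (simp add: s_def abs_mult)
    then have "\<bar>sinh (Im (of_real pi * z))\<bar> = s"
      using s by (cases "pi * Im z \<ge> 0") auto
    then have sin: "s \<le> norm (sin (of_real pi * z))"
      using norm_sin_ge_sinh_Im[of "of_real pi * z"] by simp
    have rG: "norm (rGamma (1 - z)) \<le> C * K powr (- Re (1 - z))"
      using C(2)[of "1 - z"] z by auto
    have "norm (Gamma z) = pi / norm (sin (of_real pi * z)) * norm (rGamma (1 - z))"
      using sin s by (subst Gamma_eq_rGamma_reflected) (auto simp: norm_mult norm_divide)
    also have "\<dots> \<le> pi / s * (C * K powr (- Re (1 - z)))"
      using s sin rG by (intro mult_mono frac_le) auto
    also have "K powr (- Re (1 - z)) = K powr Re z / K"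
      using K by (simp add: powr_diff)
    finally show ?thesis by simp
  qed
  moreover have "pi / s * C / K > 0" using C(1) K s by simp
  ultimately show ?thesis by blast
qed

text \<open>
  Euler's finite approximation of \<open>1 / \<Gamma>\<close>, shifted by one index with respect to the product
  \<open>rGamma_series\<close>. In this form it is exactly what the ratio \<open>\<Gamma>(\<sigma> + 1) / \<Gamma>(\<sigma> - n + 1)\<close> becomes at \<open>z = - \<sigma>\<close>
  after rescaling by powers of \<open>n\<close>.
\<close>
definition rGamma_quotient :: "complex \<Rightarrow> nat \<Rightarrow> complex" where
  "rGamma_quotient z n = pochhammer z n / (fact (n - 1) * of_nat n powr z)"

lemma rGamma_quotient_LIMSEQ: "rGamma_quotient z \<longlonglongrightarrow> rGamma z"
proof -
  have "(\<lambda>n. of_nat n / (z + of_nat n)) \<longlonglongrightarrow> 1"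
  proof (rule Lim_transform_eventually)
    have "(\<lambda>n. 1 / (z * inverse (of_nat n) + 1)) \<longlonglongrightarrow> 1 / (z * 0 + 1)"
      by (intro tendsto_intros lim_inverse_n) auto
    then show "(\<lambda>n. 1 / (z * inverse (of_nat n) + 1)) \<longlonglongrightarrow> 1" by simp
    show "\<forall>\<^sub>F n in sequentially. 1 / (z * inverse (of_nat n) + 1) = of_nat n / (z + of_nat n)"
      using eventually_gt_at_top[of 0]
    proof eventually_elim
      case (elim n)
      then have "z * inverse (of_nat n) + 1 = (z + of_nat n) / of_nat n" by (simp add: field_simps)
      then show ?case by simp
    qed
  qed
  then have "(\<lambda>n. rGamma_series z n * (of_nat n / (z + of_nat n))) \<longlonglongrightarrow> rGamma z * 1"
    by (intro tendsto_intros)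
  moreover have "eventually (\<lambda>n. rGamma_series z n * (of_nat n / (z + of_nat n)) = rGamma_quotient z n) sequentially"
    using eventually_gt_at_top[of "nat \<lceil>norm z\<rceil>"]
  proof eventually_elim
    case (elim n)
    then have n: "norm z < real n" by linarith
    have "z + of_nat n \<noteq> 0"
    proof
      assume "z + of_nat n = 0"
      then have "z = - of_nat n" by (simp add: add_eq_0_iff)
      then show False using n by simp
    qed
    moreover have "n > 0" using n norm_ge_zero[of z] by linarith
    moreover have "fact n = (of_nat n * fact (n - 1) :: complex)"
      using \<open>n > 0\<close> by (simp add: fact_reduce)
    moreover have "of_nat n powr z = exp (z * of_real (ln (real n)))"
      using \<open>n > 0\<close> by (simp add: powr_def Ln_of_nat)
    ultimately show ?case
      by (simp add: rGamma_series_def rGamma_quotient_def pochhammer_Suc)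
  qed
  ultimately show ?thesis by (simp add: Lim_transform_eventually)
qed

text \<open>
  The crude bound \<open>\<bar>1 + w\<bar>\<^sup>2 \<le> exp (2 Re w + \<bar>w\<bar>\<^sup>2)\<close> would make the next estimate grow like the exponential
  of \<open>(Re z)\<^sup>2\<close>; keeping the square of the imaginary part only makes it grow like an exponential.
\<close>
lemma norm_one_plus_le_exp:
  fixes w :: complex
  assumes "Re w \<ge> 0"
  shows "norm (1 + w) \<le> exp (Re w + (Im w)\<^sup>2 / 2)"
proof -
  have "norm (1 + w) ^ 2 = (1 + Re w)\<^sup>2 + (Im w)\<^sup>2" by (simp add: cmod_power2)
  also have "\<dots> \<le> (1 + Re w)\<^sup>2 * (1 + (Im w)\<^sup>2)"
  proof -
    have "1 * (Im w)\<^sup>2 \<le> (1 + Re w)\<^sup>2 * (Im w)\<^sup>2"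
      using assms by (intro mult_right_mono) auto
    then show ?thesis by (simp add: distrib_left)
  qed
  also have "\<dots> \<le> (exp (Re w))\<^sup>2 * exp ((Im w)\<^sup>2)"
    using assms by (intro mult_mono power_mono exp_ge_add_one_self) auto
  also have "\<dots> = exp (Re w + (Im w)\<^sup>2 / 2) ^ 2"
    by (simp add: exp_add power_mult_distrib power2_eq_square flip: exp_add)
  finally show ?thesis by (rule power2_le_imp_le) auto
qed

text \<open>
  This bound is uniform in \<open>n\<close> and at most exponential in \<open>Re z\<close>, which makes dominated convergence
  applicable along the unbounded contour. Passing from \<open>n\<close> to \<open>n + 1\<close> multiplies \<open>\<bar>pochhammer z n\<bar>\<close> by
  \<open>\<bar>z + n\<bar> \<le> n (1 + 1 / n)\<^bsup>Re z\<^esup> exp (A / n\<^sup>2)\<close> with \<open>A = Re z + (Im z)\<^sup>2\<close>; the first two factors build up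
  \<open>(n - 1)! n\<^bsup>Re z\<^esup>\<close>, and the sum of \<open>A / n\<^sup>2\<close> stays below \<open>2 A\<close>.
\<close>
lemma norm_rGamma_quotient_le:
  assumes n: "n \<ge> 1" and z: "Re z \<ge> 0"
  shows "norm (rGamma_quotient z n) \<le> norm z * exp (2 * (Re z + (Im z)\<^sup>2))"
proof -
  define A where "A = Re z + (Im z)\<^sup>2"
  have A: "A \<ge> 0" using z by (simp add: A_def)
  have factor: "norm (z + of_nat n) \<le> real n * (1 + 1 / real n) powr Re z * exp (A / (real n)\<^sup>2)"
    if n: "n \<ge> 1" for n
  proof -
    have "norm (z + of_nat n) = real n * norm (1 + z / of_nat n)"
    proof -
      have "z + of_nat n = of_nat n * (1 + z / of_nat n)" using n by (simp add: field_simps)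
      then show ?thesis by (simp add: norm_mult)
    qed
    also have "norm (1 + z / of_nat n) \<le> exp (Re (z / of_nat n) + (Im (z / of_nat n))\<^sup>2 / 2)"
      using z n by (intro norm_one_plus_le_exp) (simp add: Re_divide_of_nat)
    also have "\<dots> = exp (Re z / real n + (Im z)\<^sup>2 / (2 * (real n)\<^sup>2))"
      by (simp add: power_divide Re_divide_of_nat Im_divide_of_nat mult.commute)
    also have "\<dots> \<le> exp (Re z * ln (1 + 1 / real n) + A / (real n)\<^sup>2)"
    proof -
      have "1 / real n - (1 / real n)\<^sup>2 \<le> ln (1 + 1 / real n)"
        using n by (intro ln_one_plus_pos_lower_bound) auto
      then have "Re z * (1 / real n - (1 / real n)\<^sup>2) \<le> Re z * ln (1 + 1 / real n)"
        using z by (rule mult_left_mono)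
      moreover have "(Im z)\<^sup>2 / (2 * (real n)\<^sup>2) \<le> (Im z)\<^sup>2 / (real n)\<^sup>2"
        using n by (intro divide_left_mono) auto
      ultimately show ?thesis
        by (simp add: A_def add_divide_distrib right_diff_distrib power_divide)
    qed
    also have "\<dots> = (1 + 1 / real n) powr Re z * exp (A / (real n)\<^sup>2)"
      using n by (simp add: exp_add powr_def add_pos_pos less_imp_neq[THEN not_sym])
    finally show ?thesis by (simp add: mult.assoc mult_left_mono)
  qed
  \<comment> \<open>The last factor telescopes: \<open>1 / n\<^sup>2 \<le> 2 / n - 2 / (n + 1)\<close> for \<open>n \<ge> 1\<close>.\<close>
  have "norm (pochhammer z n) \<le> norm z * fact (n - 1) * real n powr Re z * exp (2 * A * (1 - 1 / real n))"
    using n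
  proof (induction n rule: dec_induct)
    case base
    then show ?case by simp
  next
    case (step n)
    have n: "n \<ge> 1" using step by simp
    have "norm (pochhammer z (Suc n)) = norm (pochhammer z n) * norm (z + of_nat n)"
      by (simp add: pochhammer_Suc norm_mult)
    also have "\<dots> \<le> (norm z * fact (n - 1) * real n powr Re z * exp (2 * A * (1 - 1 / real n))) *
        (real n * (1 + 1 / real n) powr Re z * exp (A / (real n)\<^sup>2))"
      using step.IH factor[OF n] by (intro mult_mono) auto
    also have "\<dots> = norm z * (real n * fact (n - 1)) * (real n powr Re z * (1 + 1 / real n) powr Re z) *
        exp (2 * A * (1 - 1 / real n) + A / (real n)\<^sup>2)"
      by (simp add: exp_add)
    also have "real n * fact (n - 1) = fact n" using n by (simp add: fact_reduce)
    also have "real n powr Re z * (1 + 1 / real n) powr Re z = real (Suc n) powr Re z"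
    proof -
      have "real (Suc n) = real n * (1 + 1 / real n)" using n by (simp add: field_simps)
      then show ?thesis by (simp only: powr_mult)
    qed
    also have "exp (2 * A * (1 - 1 / real n) + A / (real n)\<^sup>2) \<le> exp (2 * A * (1 - 1 / real (Suc n)))"
    proof -
      have "1 / (real n)\<^sup>2 \<le> 2 / real n - 2 / real (Suc n)"
      proof -
        define x where "x = real n"
        have x: "x \<ge> 1" using n by (simp add: x_def)
        have "2 / x - 2 / (x + 1) - 1 / x\<^sup>2 = (x - 1) / (x\<^sup>2 * (x + 1))"
          using x by (simp add: divide_simps) (simp add: algebra_simps power2_eq_square)
        also have "\<dots> \<ge> 0" using x by simp
        finally show ?thesis by (simp add: x_def algebra_simps)
      qed
      then have "A * (1 / (real n)\<^sup>2) \<le> A * (2 / real n - 2 / real (Suc n))"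
        using A by (rule mult_left_mono)
      then show ?thesis by (simp add: algebra_simps)
    qed
    finally show ?case by (simp add: mult_left_mono)
  qed
  also have "\<dots> \<le> norm z * fact (n - 1) * real n powr Re z * exp (2 * A)"
    using n A by (intro mult_left_mono) (auto simp: field_simps mult_left_mono)
  finally show ?thesis
    using n by (simp add: rGamma_quotient_def norm_divide norm_mult norm_powr_real_powr field_simps A_def)
qed

section \<open>Residue evaluation over rectangles and half-strips\<close>

text \<open>
  The residue theorem is applied in the vertical strip \<open>- c < Re z < N\<close>, so that \<open>f\<close> may have infinitely
  many poles on the positive axis and only those at \<open>0, \<dots>, N - 1\<close> matter.
\<close>
lemma rectpath_integral_eq_sum_residues:
  fixes N :: nat
  assumes holo: "f holomorphic_on {z. - c < Re z} - range of_nat"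
    and N: "N \<ge> 1"
    and ab: "- c < Re a" "Re a < 0" "real N - 1 < Re b" "Re b < real N" "Im a < 0" "0 < Im b"
  shows "contour_integral (rectpath a b) f = 2 * pi * \<i> * (\<Sum>k<N. residue f (of_nat k))"
proof -
  define S where "S = {z. - c < Re z} \<inter> {z. Re z < real N}"
  define pts where "pts = (of_nat :: nat \<Rightarrow> complex) ` {..<N}"
  have conv: "convex S" "open S"
    unfolding S_def by (auto intro!: convex_Int convex_halfspace_Re_lt convex_halfspace_Re_gt
        open_Int open_halfspace_Re_lt open_halfspace_Re_gt)
  have image: "path_image (rectpath a b) \<subseteq> S - pts"
    using ab N by (subst path_image_rectpath) (auto simp: S_def pts_def)
  have "contour_integral (rectpath a b) f =
      2 * pi * \<i> * (\<Sum>p\<in>pts. winding_number (rectpath a b) p * residue f p)"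
  proof (rule Residue_theorem)
    show "open S" "connected S" "finite pts"
      using conv by (auto simp: pts_def intro: convex_connected)
    show "f holomorphic_on S - pts"
      by (rule holomorphic_on_subset[OF holo]) (auto simp: S_def pts_def)
    show "path_image (rectpath a b) \<subseteq> S - pts" by (rule image)
    show "\<forall>z. z \<notin> S \<longrightarrow> winding_number (rectpath a b) z = 0"
      using image conv by (auto intro!: winding_number_zero_outside[where s = S])
  qed auto
  also have "(\<Sum>p\<in>pts. winding_number (rectpath a b) p * residue f p) = (\<Sum>p\<in>pts. residue f p)"
  proof (rule sum.cong)
    fix p assume "p \<in> pts"
    then obtain k where k: "p = of_nat k" "k < N" by (auto simp: pts_def)
    then have "real k \<le> real N - 1" by linarith
    then have "p \<in> box a b" using ab k by (auto simp: in_box_complex_iff)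
    then show "winding_number (rectpath a b) p * residue f p = residue f p"
      by (simp add: winding_number_rectpath)
  qed simp
  also have "\<dots> = (\<Sum>k<N. residue f (of_nat k))"
    unfolding pts_def by (subst sum.reindex) (auto simp: inj_on_def)
  finally show ?thesis .
qed

lemma set_integrable_exp_uminus: "set_integrable lborel {0..} (\<lambda>t::real. exp (- t))"
proof -
  have "set_integrable lebesgue {0..} (\<lambda>t::real. exp (- 1 * t))"
    using integrable_on_exp_minus_to_infinity[of 1 0]
    by (intro nonnegative_absolutely_integrable_1) auto
  then show ?thesis
    unfolding set_integrable_def by (subst (asm) integrable_completion) auto
qed

lemma linepath_integral_tendsto_ray_integral:
  assumes cont: "continuous_on ((\<lambda>t. a + of_real t) ` {0..}) f"
    and bound: "\<And>t. t \<ge> 0 \<Longrightarrow> norm (f (a + of_real t)) \<le> C * exp (- t)"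
    and L: "filterlim L at_top sequentially"
  shows "(\<lambda>n. contour_integral (linepath a (a + of_real (L n))) f) \<longlonglongrightarrow> ray_integral a 1 f"
proof -
  define g where "g = (\<lambda>t. f (a + of_real t))"
  have g: "continuous_on {0..} g"
    unfolding g_def by (rule continuous_on_compose2[OF cont]) (auto intro!: continuous_intros)
  have exp: "set_integrable lborel {0..} (\<lambda>t::real. C * exp (- t))"
    by (intro set_integrable_mult_right set_integrable_exp_uminus)
  have int: "set_integrable lborel {0..} (\<lambda>t. f (a + of_real t))"
  proof (rule set_integrable_bound[OF exp])
    show "set_borel_measurable lborel {0..} (\<lambda>t. f (a + of_real t))"
      using borel_measurable_continuous_on_indicator[OF _ g]
      by (simp add: set_borel_measurable_def g_def)
  qed (use bound in \<open>auto intro!: AE_I2 order_trans[OF bound]\<close>)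
  have "((\<lambda>b. set_lebesgue_integral lborel {0..b} g) \<longlongrightarrow> set_lebesgue_integral lborel {0..} g) at_top"
    using int by (intro tendsto_set_lebesgue_integral_at_top) (auto simp: g_def)
  then have lim: "(\<lambda>n. set_lebesgue_integral lborel {0..L n} g) \<longlonglongrightarrow> ray_integral a 1 f"
    using L by (auto simp: ray_integral_def g_def intro: filterlim_compose)
  have "eventually (\<lambda>n. set_lebesgue_integral lborel {0..L n} g =
      contour_integral (linepath a (a + of_real (L n))) f) sequentially"
    using L[unfolded filterlim_at_top_dense, rule_format, of 0]
  proof eventually_elim
    case (elim n)
    have "set_integrable lborel {0..L n} g"
      using int unfolding g_def by (rule set_integrable_subset) auto
    note * = set_borel_integral_eq_integral[OF this]
    have "((\<lambda>x. g (L n * x)) has_integral (1 / \<bar>L n\<bar>) *\<^sub>R integral {0..L n} g) ((\<lambda>x. x / L n) ` {0..L n})"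
      using elim *(1) by (intro has_integral_stretch_real) (auto simp: integrable_integral)
    also have "(\<lambda>x. x / L n) ` {0..L n} = {0..1}" using elim by (simp add: image_divide_atLeastAtMost)
    finally have "((\<lambda>x. g (L n * x) * of_real (L n)) has_integral
        ((1 / \<bar>L n\<bar>) *\<^sub>R integral {0..L n} g) * of_real (L n)) {0..1}"
      by (rule has_integral_mult_left)
    then have "contour_integral (linepath a (a + of_real (L n))) f = integral {0..L n} g"
      using elim by (intro contour_integral_unique, unfold has_contour_integral_linepath)
        (simp add: g_def linepath_def algebra_simps scaleR_conv_of_real)
    then show ?case using *(2) by simp
  qed
  with lim show "(\<lambda>n. contour_integral (linepath a (a + of_real (L n))) f) \<longlonglongrightarrow> ray_integral a 1 f"
    by (rule Lim_transform_eventually)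
qed

text \<open>
  The half-strip is exhausted by rectangles with right edge \<open>Re z = n + 1 / 2\<close>. Exponential decay on the
  horizontal sides turns them into the two rays of the contour, and decay on the right edges makes their
  contribution vanish.
\<close>
lemma S_zeta_integral_sums_residues:
  assumes holo: "f holomorphic_on {z. - c < Re z} - range of_nat"
    and c: "0 < c'" "c' < c" and \<delta>: "0 < \<delta>" and C: "C \<ge> 0"
    and bound: "\<And>z. - c' \<le> Re z \<Longrightarrow> \<bar>Im z\<bar> = \<delta> \<Longrightarrow> norm (f z) \<le> C * exp (- Re z)"
    and bound': "\<And>z n. \<bar>Im z\<bar> \<le> \<delta> \<Longrightarrow> Re z = real n + 1 / 2 \<Longrightarrow> norm (f z) \<le> C * exp (- Re z)"
  shows "(\<lambda>k. 2 * pi * \<i> * residue f (of_nat k)) sums S_zeta_integral c' \<delta> f"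
proof -
  define a1 a4 where "a1 = Complex (- c') (- \<delta>)" and "a4 = Complex (- c') \<delta>"
  define L where "L = (\<lambda>n. real n + 1 / 2 + c')"
  define a2 a3 where "a2 = (\<lambda>n. Complex (real n + 1 / 2) (- \<delta>))" and "a3 = (\<lambda>n. Complex (real n + 1 / 2) \<delta>)"
  have contf: "continuous_on A f" if "\<And>z. z \<in> A \<Longrightarrow> - c' \<le> Re z \<and> (Im z \<noteq> 0 \<or> Re z \<notin> range of_nat)" for A
  proof (rule continuous_on_subset[OF holomorphic_on_imp_continuous_on[OF holo]], safe)
    fix z assume "z \<in> A"
    from that[OF this] c show "- c < Re z" by linarith
  next
    fix k assume "of_nat k \<in> A"
    from that[OF this] show False by auto
  qed
  have L: "filterlim L at_top sequentially"
    unfolding L_def by real_asymp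
  have ray: "(\<lambda>n. contour_integral (linepath a (a + of_real (L n))) f) \<longlonglongrightarrow> ray_integral a 1 f"
    if a: "Re a = - c'" "\<bar>Im a\<bar> = \<delta>" for a
  proof (rule linepath_integral_tendsto_ray_integral[OF _ _ L])
    show "continuous_on ((\<lambda>t. a + of_real t) ` {0..}) f"
      by (rule contf) (use a \<delta> in auto)
    fix t :: real assume "t \<ge> 0"
    then have "norm (f (a + of_real t)) \<le> C * exp (- Re (a + of_real t))"
      using a by (intro bound) auto
    then show "norm (f (a + of_real t)) \<le> C * exp c' * exp (- t)"
      using a by (simp add: exp_add exp_diff exp_minus field_simps)
  qed
  have half: "real n + 1 / 2 \<noteq> real k" for n k
  proof
    assume "real n + 1 / 2 = real k"
    then have "real (2 * n + 1) = real (2 * k)" by simp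
    then have "2 * n + 1 = 2 * k" by (simp only: of_nat_eq_iff)
    then show False by presburger
  qed
  have right: "(\<lambda>n. contour_integral (linepath (a2 n) (a3 n)) f) \<longlonglongrightarrow> 0"
  proof (rule Lim_null_comparison)
    show "(\<lambda>n. C * exp (- (real n + 1 / 2)) * (2 * \<delta>)) \<longlonglongrightarrow> 0"
      by real_asymp
    show "\<forall>\<^sub>F n in sequentially. norm (contour_integral (linepath (a2 n) (a3 n)) f) \<le>
        C * exp (- (real n + 1 / 2)) * (2 * \<delta>)"
    proof (intro always_eventually allI)
      fix n
      have seg: "Re z = real n + 1 / 2 \<and> \<bar>Im z\<bar> \<le> \<delta>" if "z \<in> closed_segment (a2 n) (a3 n)" for z
        using that \<delta> by (auto simp: a2_def a3_def closed_segment_same_Re closed_segment_eq_real_ivl)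
      have "norm (contour_integral (linepath (a2 n) (a3 n)) f) \<le>
          C * exp (- (real n + 1 / 2)) * norm (a3 n - a2 n)"
      proof (rule contour_integral_bound_linepath)
        show "f contour_integrable_on linepath (a2 n) (a3 n)"
          by (intro contour_integrable_continuous_linepath contf) (use seg half[of n] c in fastforce)
        show "norm (f z) \<le> C * exp (- (real n + 1 / 2))" if "z \<in> closed_segment (a2 n) (a3 n)" for z
          using bound'[of z n] seg[OF that] by simp
      qed (use C in auto)
      also have "a3 n - a2 n = of_real (2 * \<delta>) * \<i>"
        by (simp add: a2_def a3_def complex_eq_iff)
      finally show "norm (contour_integral (linepath (a2 n) (a3 n)) f) \<le>
        C * exp (- (real n + 1 / 2)) * (2 * \<delta>)" using \<delta> by (simp add: norm_mult)
    qed
  qed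
  have eq: "(\<Sum>k<Suc n. 2 * pi * \<i> * residue f (of_nat k)) =
      contour_integral (linepath a1 (a1 + of_real (L n))) f + contour_integral (linepath (a2 n) (a3 n)) f
      - contour_integral (linepath a4 (a4 + of_real (L n))) f + contour_integral (linepath a4 a1) f" for n
  proof -
    have a23: "a1 + of_real (L n) = a2 n" "a4 + of_real (L n) = a3 n"
      by (auto simp: a1_def a4_def a2_def a3_def L_def complex_eq_iff)
    have "2 * pi * \<i> * (\<Sum>k<Suc n. residue f (of_nat k)) = contour_integral (rectpath a1 (a3 n)) f"
      using c \<delta> by (intro rectpath_integral_eq_sum_residues[OF holo, symmetric])
        (auto simp: a1_def a3_def)
    also have "rectpath a1 (a3 n) =
        linepath a1 (a2 n) +++ linepath (a2 n) (a3 n) +++ linepath (a3 n) a4 +++ linepath a4 a1"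
      by (simp add: rectpath_def Let_def a1_def a3_def a2_def a4_def)
    also have "contour_integral \<dots> f = contour_integral (linepath a1 (a2 n)) f +
        (contour_integral (linepath (a2 n) (a3 n)) f +
          (contour_integral (linepath (a3 n) a4) f + contour_integral (linepath a4 a1) f))"
    proof -
      have "closed_segment a1 (a2 n) \<union> closed_segment (a2 n) (a3 n) \<union> closed_segment (a3 n) a4 \<union>
          closed_segment a4 a1 = path_image (rectpath a1 (a3 n))"
        unfolding rectpath_def Let_def
        by (simp add: path_image_join Un_assoc) (simp add: a1_def a2_def a3_def a4_def)
      moreover have "path_image (rectpath a1 (a3 n)) \<subseteq> {z. - c < Re z} - range of_nat"
        using c \<delta> half[of n, THEN not_sym] by (subst path_image_rectpath) (auto simp: a1_def a3_def)
      ultimately have "continuous_on (closed_segment a1 (a2 n) \<union> closed_segment (a2 n) (a3 n) \<union>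
          closed_segment (a3 n) a4 \<union> closed_segment a4 a1) f"
        using holomorphic_on_imp_continuous_on[OF holo] continuous_on_subset by metis
      then have "f contour_integrable_on linepath a1 (a2 n)" "f contour_integrable_on linepath (a2 n) (a3 n)"
        "f contour_integrable_on linepath (a3 n) a4" "f contour_integrable_on linepath a4 a1"
        by (auto intro!: contour_integrable_continuous_linepath elim: continuous_on_subset)
      then show ?thesis by (simp add: contour_integrable_joinI)
    qed
    also have "contour_integral (linepath (a3 n) a4) f = - contour_integral (linepath a4 (a3 n)) f"
      using contour_integral_reversepath[of "linepath a4 (a3 n)" f] by simp
    finally show ?thesis unfolding a23 sum_distrib_left[symmetric] by (simp add: algebra_simps del: sum.lessThan_Suc)
  qed
  have "(\<lambda>n. \<Sum>k<Suc n. 2 * pi * \<i> * residue f (of_nat k)) \<longlonglongrightarrow>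
      ray_integral a1 1 f + 0 - ray_integral a4 1 f + contour_integral (linepath a4 a1) f"
    unfolding eq using \<delta> by (intro tendsto_intros ray right) (auto simp: a1_def a4_def)
  then have "(\<lambda>n. \<Sum>k<n. 2 * pi * \<i> * residue f (of_nat k)) \<longlonglongrightarrow>
      ray_integral a1 1 f + 0 - ray_integral a4 1 f + contour_integral (linepath a4 a1) f"
    by (rule LIMSEQ_imp_Suc)
  then show ?thesis
    unfolding sums_def by (simp add: S_zeta_integral_def hook_integral_def a1_def a4_def algebra_simps)
qed

text \<open>
  For \<open>0 \<le> k < n\<close> the point \<open>k\<close> corresponds to the pole of \<open>\<Gamma>\<close> at \<open>- (n - 1 - k)\<close>. The sign is split off in
  the form in which it cancels against the sign of \<open>\<Gamma>(\<sigma> + 1) / \<Gamma>(\<sigma> - n + 1)\<close>.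
\<close>
lemma residue_Gamma_ratio:
  assumes g: "g holomorphic_on S" and S: "open S" "of_nat k \<in> S" and k: "k < n"
  shows "residue (\<lambda>z. Gamma (z - of_nat n + 1) * rGamma (z + 1) * g z) (of_nat k) =
    (-1) ^ n * (- ((-1) ^ k) / (fact k * fact (n - 1 - k))) * g (of_nat k)"
proof -
  define m where "m = n - 1 - k"
  have n: "n = Suc (k + m)" using k by (simp add: m_def)
  define T where "T = S \<inter> ball (of_nat k) 1"
  have T: "open T" "of_nat k \<in> T" using S by (auto simp: T_def)
  have "residue (\<lambda>z. Gamma (z - of_nat n + 1) * rGamma (z + 1) * g z) (of_nat k) =
      (-1) ^ m / fact m * rGamma (of_nat k + 1) * g (of_nat k)"
  proof (rule residue_simple'[OF T])
    show "(\<lambda>z. Gamma (z - of_nat n + 1) * rGamma (z + 1) * g z) holomorphic_on T - {of_nat k}"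
    proof (intro holomorphic_intros)
      show "g holomorphic_on T - {of_nat k}" using g by (rule holomorphic_on_subset) (auto simp: T_def)
      fix z :: complex assume z: "z \<in> T - {of_nat k}"
      show "z - of_nat n + 1 \<notin> \<int>\<^sub>\<le>\<^sub>0"
      proof
        assume "z - of_nat n + 1 \<in> \<int>\<^sub>\<le>\<^sub>0"
        then obtain i where "z - of_nat n + 1 = of_int i" by (auto elim: nonpos_Ints_cases)
        then have i: "z - of_nat k = of_int (i + int m)" by (simp add: n algebra_simps)
        moreover have "norm (z - of_nat k) < 1" using z by (simp add: T_def dist_norm norm_minus_commute)
        ultimately have "\<bar>real_of_int (i + int m)\<bar> < 1" by (simp only: norm_of_int)
        then have "i + int m = 0" by linarith
        then show False using z i by simp
      qed
    qed
    have "((\<lambda>z. Gamma (z - of_nat n + 1) * (z - of_nat n + 1 + of_nat m)) \<longlongrightarrow> (-1) ^ m / fact m) (at (of_nat k :: complex))"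
    proof (rule filterlim_compose[OF Gamma_residues])
      show "filterlim (\<lambda>z. z - of_nat n + 1) (at (- of_nat m)) (at (of_nat k :: complex))"
        by (intro filterlim_atI) (auto intro!: tendsto_eq_intros simp: n eventually_at_filter)
    qed
    moreover have "isCont g (of_nat k)"
      using g S by (meson at_within_open continuous_on_eq_continuous_at holomorphic_on_imp_continuous_on)
    ultimately have "((\<lambda>z. (Gamma (z - of_nat n + 1) * (z - of_nat n + 1 + of_nat m)) * rGamma (z + 1) * g z)
        \<longlongrightarrow> (-1) ^ m / fact m * rGamma (of_nat k + 1) * g (of_nat k)) (at (of_nat k))"
      using isCont_rGamma[OF isCont_add[OF continuous_ident continuous_const], of "of_nat k :: complex" 1]
      by (intro tendsto_mult) (simp_all add: isCont_def)
    then show "((\<lambda>z. (Gamma (z - of_nat n + 1) * rGamma (z + 1) * g z) * (z - of_nat k))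
        \<longlongrightarrow> (-1) ^ m / fact m * rGamma (of_nat k + 1) * g (of_nat k)) (at (of_nat k))"
      by (simp add: n algebra_simps)
  qed
  also have "rGamma (of_nat k + 1 :: complex) = 1 / fact k"
    using Gamma_fact[of k, where 'a=complex] by (simp add: rGamma_inverse_Gamma field_simps)
  also have "(-1) ^ m = (-1) ^ n * - ((-1) ^ k :: complex)"
    by (simp add: n power_add mult_ac flip: power_mult_distrib)
  finally show ?thesis by (simp add: m_def)
qed

lemma residue_Gamma_uminus:
  assumes g: "g holomorphic_on S" and S: "open S" "of_nat k \<in> S"
  shows "residue (\<lambda>z. Gamma (- z) * g z) (of_nat k) = - ((-1) ^ k) / fact k * g (of_nat k)"
proof -
  define T where "T = S \<inter> ball (of_nat k) 1"
  have T: "open T" "of_nat k \<in> T" using S by (auto simp: T_def)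
  show ?thesis
  proof (rule residue_simple'[OF T])
    show "(\<lambda>z. Gamma (- z) * g z) holomorphic_on T - {of_nat k}"
    proof (intro holomorphic_intros)
      show "g holomorphic_on T - {of_nat k}" using g by (rule holomorphic_on_subset) (auto simp: T_def)
      fix z :: complex assume z: "z \<in> T - {of_nat k}"
      show "- z \<notin> \<int>\<^sub>\<le>\<^sub>0"
      proof
        assume "- z \<in> \<int>\<^sub>\<le>\<^sub>0"
        then obtain i where "- z = of_int i" by (auto elim: nonpos_Ints_cases)
        then have i: "z - of_nat k = of_int (- i - int k)" by (simp add: minus_equation_iff[of z])
        moreover have "norm (z - of_nat k) < 1" using z by (simp add: T_def dist_norm norm_minus_commute)
        ultimately have "\<bar>real_of_int (- i - int k)\<bar> < 1" by (simp only: norm_of_int)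
        then have "- i - int k = 0" by linarith
        then have "z - of_nat k = 0" using i by (simp only: of_int_0)
        then show False using z by simp
      qed
    qed
    have "((\<lambda>z. Gamma (- z) * (- z + of_nat k)) \<longlongrightarrow> (-1) ^ k / fact k) (at (of_nat k :: complex))"
    proof (rule filterlim_compose[OF Gamma_residues])
      show "filterlim (\<lambda>z. - z) (at (- of_nat k)) (at (of_nat k :: complex))"
        by (intro filterlim_atI) (auto intro!: tendsto_eq_intros simp: eventually_at_filter)
    qed
    moreover have "isCont g (of_nat k)"
      using g S by (meson at_within_open continuous_on_eq_continuous_at holomorphic_on_imp_continuous_on)
    ultimately have "((\<lambda>z. - (Gamma (- z) * (- z + of_nat k)) * g z)
        \<longlongrightarrow> - ((-1) ^ k / fact k) * g (of_nat k)) (at (of_nat k))"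
      by (intro tendsto_intros) (auto simp: isCont_def)
    then show "((\<lambda>z. (Gamma (- z) * g z) * (z - of_nat k))
        \<longlongrightarrow> - ((-1) ^ k) / fact k * g (of_nat k)) (at (of_nat k))"
      by (simp add: algebra_simps)
  qed
qed

section \<open>The integrands in \<open>\<sigma>\<close> and their uniform convergence\<close>

text \<open>
  Uniformity in the parameter \<open>p\<close> costs nothing in the dominated convergence theorem once the integrands
  differ by at most a function \<open>E n\<close> that does not depend on \<open>p\<close>: the theorem is then applied to \<open>E n\<close>.
\<close>
lemma uniform_limit_integral_dominated:
  fixes F :: "nat \<Rightarrow> 'p \<Rightarrow> 'a \<Rightarrow> complex" and w :: "'a \<Rightarrow> real"
  assumes F: "\<And>n p. p \<in> K \<Longrightarrow> F n p \<in> borel_measurable M"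
    and G: "\<And>p. p \<in> K \<Longrightarrow> integrable M (G p)"
    and E: "\<And>n. E n \<in> borel_measurable M" and w: "integrable M w"
    and diff: "\<And>n p t. n \<ge> 1 \<Longrightarrow> p \<in> K \<Longrightarrow> t \<in> space M \<Longrightarrow> norm (F n p t - G p t) \<le> E n t"
    and Ew: "\<And>n t. n \<ge> 1 \<Longrightarrow> t \<in> space M \<Longrightarrow> \<bar>E n t\<bar> \<le> w t"
    and lim: "\<And>t. t \<in> space M \<Longrightarrow> (\<lambda>n. E n t) \<longlonglongrightarrow> 0"
  shows "uniform_limit K (\<lambda>n p. LINT t|M. F n p t) (\<lambda>p. LINT t|M. G p t) sequentially"
    and "\<And>n p. n \<ge> 1 \<Longrightarrow> p \<in> K \<Longrightarrow> integrable M (F n p)"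
proof -
  have Eint: "integrable M (E n)" if "n \<ge> 1" for n
    by (rule Bochner_Integration.integrable_bound[OF w E]) (use Ew that in \<open>auto intro!: AE_I2 order_trans[OF Ew]\<close>)
  have D: "integrable M (\<lambda>t. F n p t - G p t)" if "n \<ge> 1" "p \<in> K" for n p
  proof (rule Bochner_Integration.integrable_bound[OF Eint[OF that(1)]])
    show "(\<lambda>t. F n p t - G p t) \<in> borel_measurable M"
      using F[OF that(2)] borel_measurable_integrable[OF G[OF that(2)]] by (rule borel_measurable_diff)
  qed (use diff that in \<open>auto intro!: AE_I2 order_trans[OF diff]\<close>)
  show Fint: "integrable M (F n p)" if "n \<ge> 1" "p \<in> K" for n p
    using Bochner_Integration.integrable_add[OF D[OF that] G[OF that(2)]] by simp
  have "(\<lambda>n. LINT t|M. E (Suc n) t) \<longlonglongrightarrow> (LINT t|M. 0)"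
    by (rule integral_dominated_convergence[OF _ _ w])
      (use E Ew lim in \<open>auto intro!: AE_I2 LIMSEQ_Suc\<close>)
  then have E0: "(\<lambda>n. LINT t|M. E n t) \<longlonglongrightarrow> 0" by (auto intro: LIMSEQ_imp_Suc)
  show "uniform_limit K (\<lambda>n p. LINT t|M. F n p t) (\<lambda>p. LINT t|M. G p t) sequentially"
  proof (rule uniform_limitI)
    fix e :: real assume "e > 0"
    with E0 have "\<forall>\<^sub>F n in sequentially. (LINT t|M. E n t) < e" by (rule order_tendstoD)
    with eventually_ge_at_top[of 1]
    show "\<forall>\<^sub>F n in sequentially. \<forall>p\<in>K. dist (LINT t|M. F n p t) (LINT t|M. G p t) < e"
    proof eventually_elim
      case (elim n)
      show ?case
      proof
        fix p assume p: "p \<in> K"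
        have "dist (LINT t|M. F n p t) (LINT t|M. G p t) = norm (LINT t|M. F n p t - G p t)"
          using Fint[OF elim(1) p] G[OF p] by (simp add: dist_norm)
        also have "\<dots> \<le> (LINT t|M. norm (F n p t - G p t))" by (rule integral_norm_bound)
        also have "\<dots> \<le> (LINT t|M. E n t)"
          using D[OF elim(1) p] Eint[OF elim(1)] diff[OF elim(1) p] by (intro integral_mono) auto
        finally show "dist (LINT t|M. F n p t) (LINT t|M. G p t) < e" using elim by linarith
      qed
    qed
  qed
qed

text \<open>
  The number \<open>(n - 1) (n - 2) \<dots> (n - k) / n\<^bsup>k\<^esup>\<close>, by which the \<open>k\<close>-th residue of the rescaled finite kernel
  differs from that of its limit. The binomial coefficient makes it vanish for \<open>k \<ge> n\<close>, so that the
  finite residue sum may be written as a series.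
\<close>
definition falling_ratio :: "nat \<Rightarrow> nat \<Rightarrow> real" where
  "falling_ratio n k = real ((n - 1) choose k) * fact k / real n ^ k"

lemma falling_ratio_bounds: "0 \<le> falling_ratio n k" "falling_ratio n k \<le> 1"
proof -
  have "real (((n - 1) choose k) * fact k) \<le> real (n ^ k)"
    using binomial_fact_pow[of "n - 1" k] power_mono[of "n - 1" n k] by (simp only: of_nat_le_iff) linarith
  then show "falling_ratio n k \<le> 1"
    by (cases "real n ^ k = 0") (auto simp: falling_ratio_def divide_le_eq_1)
qed (simp add: falling_ratio_def)

lemma falling_ratio_LIMSEQ: "(\<lambda>n. falling_ratio n k) \<longlonglongrightarrow> 1"
proof (rule Lim_transform_eventually)
  have "(\<lambda>n. \<Prod>i=0..<k. (real n - 1 - real i) / real n) \<longlonglongrightarrow> (\<Prod>i=0..<k. 1)"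
    by (intro tendsto_prod) real_asymp
  then show "(\<lambda>n. \<Prod>i=0..<k. (real n - 1 - real i) / real n) \<longlonglongrightarrow> 1" by simp
  show "\<forall>\<^sub>F n in sequentially. (\<Prod>i=0..<k. (real n - 1 - real i) / real n) = falling_ratio n k"
    using eventually_ge_at_top[of 1]
  proof eventually_elim
    case (elim n)
    have "real ((n - 1) choose k) * fact k = (\<Prod>i=0..<k. real n - 1 - real i)"
      using elim by (simp add: binomial_gbinomial gbinomial_prod_rev of_nat_diff)
    then show ?case by (simp add: falling_ratio_def prod_dividef)
  qed
qed

definition Gamma_product :: "(nat \<Rightarrow> nat) \<Rightarrow> nat \<Rightarrow> complex \<Rightarrow> complex" where
  "Gamma_product \<nu> r \<sigma> = (\<Prod>j=1..r. Gamma (\<sigma> + of_nat (\<nu> j)))"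

text \<open>
  The \<open>k\<close>-th residue in \<open>\<zeta>\<close> of the hard-edge integrand, without \<open>1 / (\<sigma> - k)\<close> and the factors that depend
  on \<open>\<sigma>\<close> and \<open>y\<close> only.
\<close>
definition residue_coeff :: "(nat \<Rightarrow> nat) \<Rightarrow> nat \<Rightarrow> real \<Rightarrow> nat \<Rightarrow> complex" where
  "residue_coeff \<nu> q x k = - ((-1) ^ k) / fact k * of_real x ^ k * (\<Prod>j=1..q. rGamma (of_nat k + of_nat (\<nu> j)))"

lemma norm_residue_coeff_le:
  assumes \<nu>: "\<And>j. j \<ge> 1 \<Longrightarrow> \<nu> j \<ge> 1" and x: "0 \<le> x" "x \<le> A"
  shows "norm (residue_coeff \<nu> q x k) \<le> A ^ k / fact k"
proof -
  have "norm (rGamma (of_nat k + of_nat (\<nu> j)) :: complex) \<le> 1" if "j \<in> {1..q}" for j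
  proof -
    define m where "m = \<nu> j - 1"
    have m: "\<nu> j = Suc m" using \<nu>[of j] that by (simp add: m_def)
    have "rGamma (of_nat k + of_nat (\<nu> j) :: complex) = inverse (fact (k + m))"
      using Gamma_fact[of "k + m", where 'a=complex] by (simp add: m rGamma_inverse_Gamma add_ac)
    then show ?thesis by (simp add: norm_inverse inverse_le_1_iff)
  qed
  then have "(\<Prod>j=1..q. norm (rGamma (of_nat k + of_nat (\<nu> j)) :: complex)) \<le> 1"
    by (intro prod_le_1) auto
  moreover have "x ^ k / fact k \<le> A ^ k / fact k"
    using x by (intro divide_right_mono power_mono) auto
  ultimately have "x ^ k / fact k * (\<Prod>j=1..q. norm (rGamma (of_nat k + of_nat (\<nu> j)) :: complex)) \<le> A ^ k / fact k * 1"
    using x by (intro mult_mono) (auto intro: prod_nonneg)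
  then show ?thesis
    using x by (simp add: residue_coeff_def norm_mult norm_divide norm_power prod_norm)
qed

text \<open>
  The functions of \<open>\<sigma>\<close> that remain of the rescaled Ginibre kernel and of the hard-edge kernel when the
  \<open>\<zeta>\<close>-integral is replaced by the sum of its residues.
\<close>
definition ginibre_integrand ::
  "(nat \<Rightarrow> nat) \<Rightarrow> nat \<Rightarrow> nat \<Rightarrow> nat \<Rightarrow> real \<Rightarrow> real \<Rightarrow> complex \<Rightarrow> complex" where
  "ginibre_integrand \<nu> q r n x y \<sigma> =
     Gamma_product \<nu> r \<sigma> * rGamma_quotient (- \<sigma>) n * of_real y powr (- \<sigma> - 1) *
     (\<Sum>k. of_real (falling_ratio n k) * residue_coeff \<nu> q x k / (\<sigma> - of_nat k))"

definition hard_edge_integrand ::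
  "(nat \<Rightarrow> nat) \<Rightarrow> nat \<Rightarrow> nat \<Rightarrow> real \<Rightarrow> real \<Rightarrow> complex \<Rightarrow> complex" where
  "hard_edge_integrand \<nu> q r x y \<sigma> =
     Gamma_product \<nu> r \<sigma> * rGamma (- \<sigma>) * of_real y powr (- \<sigma> - 1) *
     (\<Sum>k. residue_coeff \<nu> q x k / (\<sigma> - of_nat k))"

text \<open>
  Up to the factor \<open>1 / c\<close>, a common bound for the distance between the two residue series over all
  \<open>x \<in> {0..A}\<close> and all \<open>\<sigma>\<close> with \<open>Re \<sigma> \<le> - c\<close>. It tends to \<open>0\<close> by Tannery's theorem.
\<close>
definition residue_error :: "real \<Rightarrow> nat \<Rightarrow> real" where
  "residue_error A n = (\<Sum>k. (1 - falling_ratio n k) * (A ^ k / fact k))"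

lemma summable_pow_fact: "summable (\<lambda>k. A ^ k / fact k :: real)"
  using summable_exp[of A] by (simp add: field_simps)

lemma residue_error_bounds:
  assumes "A \<ge> 0"
  shows "0 \<le> residue_error A n" "residue_error A n \<le> exp A"
    and "summable (\<lambda>k. (1 - falling_ratio n k) * (A ^ k / fact k))"
proof -
  have nn: "0 \<le> (1 - falling_ratio n k) * (A ^ k / fact k)" for k
    using assms falling_ratio_bounds by (intro mult_nonneg_nonneg) auto
  have le: "(1 - falling_ratio n k) * (A ^ k / fact k) \<le> 1 * (A ^ k / fact k)" for k
    using assms falling_ratio_bounds by (intro mult_right_mono) auto
  show s: "summable (\<lambda>k. (1 - falling_ratio n k) * (A ^ k / fact k))"
  proof (rule summable_comparison_test'[OF summable_pow_fact[of A], of 0])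
    show "norm ((1 - falling_ratio n k) * (A ^ k / fact k)) \<le> A ^ k / fact k" for k
      using le[of k] unfolding real_norm_def abs_of_nonneg[OF nn] by simp
  qed
  show "0 \<le> residue_error A n" unfolding residue_error_def by (rule suminf_nonneg[OF s nn])
  have "residue_error A n \<le> (\<Sum>k. A ^ k / fact k)"
    unfolding residue_error_def using le by (intro suminf_le s summable_pow_fact) simp
  also have "\<dots> = exp A" by (simp add: exp_def scaleR_conv_of_real field_simps)
  finally show "residue_error A n \<le> exp A" .
qed

lemma residue_error_LIMSEQ:
  assumes "A \<ge> 0"
  shows "residue_error A \<longlonglongrightarrow> 0"
proof -
  have "(\<lambda>n. \<Sum>k. (1 - falling_ratio n k) * (A ^ k / fact k)) \<longlonglongrightarrow> (\<Sum>k::nat. 0)"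
  proof (rule tannerys_theorem[THEN conjunct2, THEN conjunct2])
    show "(\<lambda>n. (1 - falling_ratio n k) * (A ^ k / fact k)) \<longlonglongrightarrow> 0" for k
      by (rule tendsto_eq_intros falling_ratio_LIMSEQ refl)+ simp
    show "\<forall>\<^sub>F (k, n) in at_top \<times>\<^sub>F sequentially. norm ((1 - falling_ratio n k) * (A ^ k / fact k)) \<le> A ^ k / fact k"
    proof (intro always_eventually allI, clarify)
      fix k n
      have "\<bar>1 - falling_ratio n k\<bar> * (A ^ k / fact k) \<le> 1 * (A ^ k / fact k)"
        using assms falling_ratio_bounds[of n k] by (intro mult_right_mono) auto
      then show "norm ((1 - falling_ratio n k) * (A ^ k / fact k)) \<le> A ^ k / fact k"
        using assms by (simp add: abs_mult)
    qed
  qed (auto simp: summable_pow_fact)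
  then show ?thesis by (simp add: residue_error_def[abs_def])
qed

text \<open>
  On the contour of \<open>\<sigma>\<close> every denominator satisfies \<open>\<bar>\<sigma> - k\<bar> \<ge> c\<close>, and \<open>1 / \<Gamma>\<close> is at most \<open>1\<close> at positive
  integers; hence all series are dominated by \<open>\<Sum>k. A\<^bsup>k\<^esup> / (k! c)\<close>, uniformly in \<open>x\<close> and \<open>\<sigma>\<close>.
\<close>
lemma residue_series_bounds:
  fixes \<nu> :: "nat \<Rightarrow> nat" and q :: nat and \<sigma> :: complex and x A c :: real
  assumes \<nu>: "\<And>j. j \<ge> 1 \<Longrightarrow> \<nu> j \<ge> 1" and x: "0 \<le> x" "x \<le> A"
    and \<sigma>: "Re \<sigma> \<le> - c" "0 < c"
  defines "S \<equiv> \<Sum>k. residue_coeff \<nu> q x k / (\<sigma> - of_nat k)"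
    and "Sn \<equiv> \<lambda>n. \<Sum>k. of_real (falling_ratio n k) * residue_coeff \<nu> q x k / (\<sigma> - of_nat k)"
  shows "summable (\<lambda>k. residue_coeff \<nu> q x k / (\<sigma> - of_nat k))"
    and "norm S \<le> exp A / c" and "norm (Sn n) \<le> exp A / c" and "norm (Sn n - S) \<le> residue_error A n / c"
proof -
  have A: "A \<ge> 0" using x by simp
  have coeff: "norm (of_real a * residue_coeff \<nu> q x k / (\<sigma> - of_nat k)) \<le> \<bar>a\<bar> * (A ^ k / fact k) / c"
    for a k
  proof -
    have "c \<le> norm (\<sigma> - of_nat k)"
      using abs_Re_le_cmod[of "\<sigma> - of_nat k"] \<sigma> by simp
    moreover have "norm (of_real a * residue_coeff \<nu> q x k) \<le> \<bar>a\<bar> * (A ^ k / fact k)"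
      unfolding norm_mult norm_of_real by (intro mult_left_mono norm_residue_coeff_le \<nu> x) auto
    ultimately show ?thesis
      unfolding norm_divide using \<sigma> A by (intro frac_le) auto
  qed
  \<comment> \<open>One estimate for the weights \<open>1\<close>, \<open>falling_ratio n k\<close> and \<open>1 - falling_ratio n k\<close>.\<close>
  have sum_bound: "summable (\<lambda>k. of_real (a k) * residue_coeff \<nu> q x k / (\<sigma> - of_nat k)) \<and>
      norm (\<Sum>k. of_real (a k) * residue_coeff \<nu> q x k / (\<sigma> - of_nat k)) \<le> B / c"
    if "\<And>k. 0 \<le> a k" "(\<lambda>k. a k * (A ^ k / fact k)) sums B" for a :: "nat \<Rightarrow> real" and B
  proof
    have s: "(\<lambda>k. a k * (A ^ k / fact k) / c) sums (B / c)" by (intro sums_divide that)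
    show "summable (\<lambda>k. of_real (a k) * residue_coeff \<nu> q x k / (\<sigma> - of_nat k))"
      by (rule summable_comparison_test'[OF sums_summable[OF s], of 0]) (use coeff[of "a _"] that(1) in simp)
    show "norm (\<Sum>k. of_real (a k) * residue_coeff \<nu> q x k / (\<sigma> - of_nat k)) \<le> B / c"
      unfolding sums_unique[OF s]
      by (rule norm_suminf_le[OF _ sums_summable[OF s]]) (use coeff[of "a _"] that(1) in simp)
  qed
  have expA: "(\<lambda>k. A ^ k / fact k) sums exp A"
    using exp_converges[of A] by (simp add: scaleR_conv_of_real field_simps)
  have one: "summable (\<lambda>k. residue_coeff \<nu> q x k / (\<sigma> - of_nat k))" "norm S \<le> exp A / c"
    using sum_bound[of "\<lambda>_. 1" "exp A"] expA by (simp_all add: S_def)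
  then show "summable (\<lambda>k. residue_coeff \<nu> q x k / (\<sigma> - of_nat k))" "norm S \<le> exp A / c" by simp_all
  have sw: "(\<lambda>k. (1 - falling_ratio n k) * (A ^ k / fact k)) sums residue_error A n"
    using residue_error_bounds(3)[OF A, of n] by (simp add: residue_error_def summable_sums)
  have "(\<lambda>k. A ^ k / fact k - (1 - falling_ratio n k) * (A ^ k / fact k)) sums (exp A - residue_error A n)"
    by (intro sums_diff expA sw)
  then have "(\<lambda>k. falling_ratio n k * (A ^ k / fact k)) sums (exp A - residue_error A n)"
    by (simp add: diff_divide_distrib left_diff_distrib)
  from sum_bound[OF falling_ratio_bounds(1) this]
  have Sn: "summable (\<lambda>k. of_real (falling_ratio n k) * residue_coeff \<nu> q x k / (\<sigma> - of_nat k))"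
    and Sn_le: "norm (Sn n) \<le> (exp A - residue_error A n) / c" by (simp_all add: Sn_def)
  note Sn_le
  also have "(exp A - residue_error A n) / c \<le> exp A / c"
    using residue_error_bounds[OF A, of n] \<sigma> by (intro divide_right_mono) auto
  finally show "norm (Sn n) \<le> exp A / c" .
  have "norm (\<Sum>k. of_real (1 - falling_ratio n k) * residue_coeff \<nu> q x k / (\<sigma> - of_nat k)) \<le> residue_error A n / c"
    using sum_bound[OF _ sw] falling_ratio_bounds(2)[of n] by simp
  also have "(\<Sum>k. of_real (1 - falling_ratio n k) * residue_coeff \<nu> q x k / (\<sigma> - of_nat k)) = S - Sn n"
    unfolding S_def Sn_def using one(1) Sn
    by (subst suminf_diff) (simp_all add: diff_divide_distrib left_diff_distrib)
  finally show "norm (Sn n - S) \<le> residue_error A n / c" by (simp add: norm_minus_commute)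
qed

lemma borel_measurable_rGamma_complex [measurable]: "(rGamma :: complex \<Rightarrow> complex) \<in> borel_measurable borel"
  by (intro borel_measurable_continuous_onI continuous_intros)

lemma borel_measurable_Gamma_complex [measurable]: "(Gamma :: complex \<Rightarrow> complex) \<in> borel_measurable borel"
proof -
  have eq: "(Gamma :: complex \<Rightarrow> complex) = (\<lambda>z. inverse (rGamma z))"
    by (simp add: fun_eq_iff rGamma_inverse_Gamma)
  show ?thesis unfolding eq by measurable
qed

lemma borel_measurable_powr_const_base [measurable]: "(\<lambda>z. a powr z) \<in> borel_measurable borel" for a :: complex
proof (cases "a = 0")
  case False
  then have "(\<lambda>z. a powr z) = (\<lambda>z. exp (z * Ln a))" by (simp add: powr_def fun_eq_iff)
  moreover have "(\<lambda>z. exp (z * Ln a)) \<in> borel_measurable borel"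
    by (intro borel_measurable_continuous_onI continuous_intros)
  ultimately show ?thesis by simp
next
  case True
  then show ?thesis by simp
qed

lemma borel_measurable_Gamma_product [measurable]: "Gamma_product \<nu> r \<in> borel_measurable borel"
  unfolding Gamma_product_def[abs_def] by measurable

lemma borel_measurable_rGamma_quotient [measurable]: "(\<lambda>z. rGamma_quotient z n) \<in> borel_measurable borel"
  unfolding rGamma_quotient_def pochhammer_prod by measurable

lemma borel_measurable_ginibre_integrand [measurable]: "ginibre_integrand \<nu> q r n x y \<in> borel_measurable borel"
  unfolding ginibre_integrand_def[abs_def] by measurable

lemma borel_measurable_hard_edge_integrand [measurable]: "hard_edge_integrand \<nu> q r x y \<in> borel_measurable borel"
  unfolding hard_edge_integrand_def[abs_def] by measurable


text \<open>
  The two integrands are compared after splitting the difference into the part due to Euler's product and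
  the part due to the residue series. The map \<open>\<gamma>\<close> parametrises one piece of the contour, and \<open>A'\<close> and \<open>m\<close>
  control \<open>y\<^bsup>- \<sigma> - 1\<^esup>\<close> for all \<open>y \<in> Y\<close> at once. A dominating function is demanded for the finite products
  only, since it is inherited by their limit.
\<close>
lemma sigma_integrals_uniform_limit:
  fixes M :: "'a measure" and \<gamma> :: "'a \<Rightarrow> complex"
  assumes \<nu>: "\<And>j. j \<ge> 1 \<Longrightarrow> \<nu> j \<ge> 1"
    and \<gamma>: "\<gamma> \<in> borel_measurable M" and Re: "\<And>t. t \<in> space M \<Longrightarrow> Re (\<gamma> t) \<le> - c" and c: "0 < c"
    and X: "X \<subseteq> {0..A}" and Y: "Y \<subseteq> {m..A'}" and m: "0 < m"
    and W: "integrable M W"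
    and bound: "\<And>t n. t \<in> space M \<Longrightarrow> n \<ge> 1 \<Longrightarrow>
      norm (Gamma_product \<nu> r (\<gamma> t)) * norm (rGamma_quotient (- \<gamma> t) n) * A' powr (- Re (\<gamma> t)) \<le> W t"
  shows "uniform_limit (X \<times> Y) (\<lambda>n (x, y). LINT t|M. ginibre_integrand \<nu> q r n x y (\<gamma> t))
      (\<lambda>(x, y). LINT t|M. hard_edge_integrand \<nu> q r x y (\<gamma> t)) sequentially"
    and "\<And>x y n. x \<in> X \<Longrightarrow> y \<in> Y \<Longrightarrow> n \<ge> 1 \<Longrightarrow> integrable M (\<lambda>t. ginibre_integrand \<nu> q r n x y (\<gamma> t))"
    and "\<And>x y. x \<in> X \<Longrightarrow> y \<in> Y \<Longrightarrow> integrable M (\<lambda>t. hard_edge_integrand \<nu> q r x y (\<gamma> t))"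
proof -
  note [measurable] = \<gamma>
  define B where "B = exp A / c"
  have B: "B \<ge> 0" using c by (simp add: B_def)
  define P where "P = (\<lambda>t. norm (Gamma_product \<nu> r (\<gamma> t)) * (A' powr (- Re (\<gamma> t)) / m))"
  define E where "E = (\<lambda>n t. P t * (norm (rGamma_quotient (- \<gamma> t) n - rGamma (- \<gamma> t)) * B
      + norm (rGamma (- \<gamma> t)) * (residue_error A n / c)))"
  have P: "P t \<ge> 0" for t using m by (simp add: P_def)
  have Pn: "P t * norm (rGamma_quotient (- \<gamma> t) n) \<le> W t / m" if "t \<in> space M" "n \<ge> 1" for t n
  proof -
    have "P t * norm (rGamma_quotient (- \<gamma> t) n) =
        norm (Gamma_product \<nu> r (\<gamma> t)) * norm (rGamma_quotient (- \<gamma> t) n) * A' powr (- Re (\<gamma> t)) / m"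
      by (simp add: P_def)
    also have "\<dots> \<le> W t / m" using bound[OF that] m by (intro divide_right_mono) auto
    finally show ?thesis .
  qed
  have Pinf: "P t * norm (rGamma (- \<gamma> t)) \<le> W t / m" if "t \<in> space M" for t
  proof (rule LIMSEQ_le_const2)
    show "(\<lambda>n. P t * norm (rGamma_quotient (- \<gamma> t) n)) \<longlonglongrightarrow> P t * norm (rGamma (- \<gamma> t))"
      by (intro tendsto_intros rGamma_quotient_LIMSEQ)
  qed (use Pn that in blast)
  have y: "norm (of_real y powr (- \<gamma> t - 1)) \<le> A' powr (- Re (\<gamma> t)) / m" if "y \<in> Y" "t \<in> space M" for y t
  proof -
    have y: "m \<le> y" "y \<le> A'" "0 < y" using that Y m by auto
    have "norm (of_real y powr (- \<gamma> t - 1)) = y powr (- Re (\<gamma> t)) / y"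
      using y by (subst norm_powr_real_powr) (auto simp: powr_diff)
    also have "\<dots> \<le> A' powr (- Re (\<gamma> t)) / m"
      using y Re[OF that(2)] c m by (intro frac_le powr_mono2) auto
    finally show ?thesis .
  qed
  have AA: "A \<ge> 0" if "x \<in> X" for x using that X by auto
  define F where "F = (\<lambda>n p t. ginibre_integrand \<nu> q r n (fst p) (snd p) (\<gamma> t))"
  define G where "G = (\<lambda>p t. hard_edge_integrand \<nu> q r (fst p) (snd p) (\<gamma> t))"
  have diff: "norm (F n p t - G p t) \<le> E n t" and Gbound: "norm (G p t) \<le> W t * B / m"
    if n: "n \<ge> 1" and p_in: "p \<in> X \<times> Y" and t: "t \<in> space M" for n p t
  proof -
    obtain x y where p: "p = (x, y)" "x \<in> X" "y \<in> Y" using p_in by blast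
    have x: "0 \<le> x" "x \<le> A" using X p by auto
    note S = residue_series_bounds[OF \<nu> x Re[OF t] c, where q = q]
    define s where "s = (\<Sum>k. residue_coeff \<nu> q x k / (\<gamma> t - of_nat k))"
    define sn where "sn = (\<Sum>k. of_real (falling_ratio n k) * residue_coeff \<nu> q x k / (\<gamma> t - of_nat k))"
    define g where "g = Gamma_product \<nu> r (\<gamma> t) * of_real y powr (- \<gamma> t - 1)"
    have g: "norm g \<le> P t"
      using mult_left_mono[OF y[OF p(3) t], of "norm (Gamma_product \<nu> r (\<gamma> t))"]
      by (simp add: g_def norm_mult P_def)
    have "F n p t - G p t = g * ((rGamma_quotient (- \<gamma> t) n - rGamma (- \<gamma> t)) * sn + rGamma (- \<gamma> t) * (sn - s))"
      by (simp add: F_def G_def p ginibre_integrand_def hard_edge_integrand_def s_def sn_def g_def algebra_simps)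
    also have "norm \<dots> \<le> norm g * (norm (rGamma_quotient (- \<gamma> t) n - rGamma (- \<gamma> t)) * norm sn
        + norm (rGamma (- \<gamma> t)) * norm (sn - s))"
      unfolding norm_mult by (intro mult_left_mono order_trans[OF norm_triangle_ineq]) (auto simp: norm_mult)
    also have "\<dots> \<le> E n t"
      unfolding E_def using S(3,4)[where n = n] g P[of t]
      by (intro mult_mono add_mono) (auto simp: s_def sn_def B_def)
    finally show "norm (F n p t - G p t) \<le> E n t" .
    have "norm (G p t) = norm g * norm (rGamma (- \<gamma> t)) * norm s"
      by (simp add: G_def p hard_edge_integrand_def s_def g_def norm_mult)
    also have "\<dots> \<le> P t * norm (rGamma (- \<gamma> t)) * B"
      using S(2) g P[of t] by (intro mult_mono) (auto simp: s_def B_def)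
    also have "\<dots> \<le> W t / m * B" using Pinf[OF t] B by (rule mult_right_mono)
    finally show "norm (G p t) \<le> W t * B / m" by simp
  qed
  have Gint: "integrable M (G p)" if "p \<in> X \<times> Y" for p
  proof (rule Bochner_Integration.integrable_bound)
    show "integrable M (\<lambda>t. W t * B / m)" using W by simp
    show "G p \<in> borel_measurable M" unfolding G_def by measurable
    show "AE t in M. norm (G p t) \<le> norm (W t * B / m)"
    proof (rule AE_I2)
      fix t assume "t \<in> space M"
      from Gbound[OF order_refl that this] abs_ge_self[of "W t * B / m"]
      show "norm (G p t) \<le> norm (W t * B / m)" unfolding real_norm_def by linarith
    qed
  qed
  note UL = uniform_limit_integral_dominated[where K = "X \<times> Y" and M = M and F = F and G = G and E = E
      and w = "\<lambda>t. 3 * (W t * B / m)"]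
  have *: "uniform_limit (X \<times> Y) (\<lambda>n p. LINT t|M. F n p t) (\<lambda>p. LINT t|M. G p t) sequentially
      \<and> (\<forall>n\<ge>1. \<forall>p\<in>X \<times> Y. integrable M (F n p))" if "X \<noteq> {}"
  proof -
    have A0: "A \<ge> 0" using AA that by auto
    have E_le: "\<bar>E n t\<bar> \<le> 3 * (W t * B / m)" if "n \<ge> 1" "t \<in> space M" for n t
    proof -
      define rn ri where "rn = norm (rGamma_quotient (- \<gamma> t) n)" and "ri = norm (rGamma (- \<gamma> t))"
      have "0 \<le> E n t" unfolding E_def
        using P[of t] B c residue_error_bounds(1)[OF A0, of n] by (intro mult_nonneg_nonneg add_nonneg_nonneg) auto
      moreover have "E n t \<le> P t * ((rn + ri) * B + ri * B)"
        unfolding E_def rn_def ri_def using P[of t] B c residue_error_bounds(2)[OF A0, of n]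
        by (intro mult_left_mono add_mono mult_right_mono norm_triangle_ineq4)
          (auto simp: B_def intro!: divide_right_mono)
      moreover have "P t * ((rn + ri) * B + ri * B) = (P t * rn) * B + 2 * ((P t * ri) * B)"
        by (simp add: algebra_simps)
      moreover have "(P t * rn) * B \<le> W t * B / m" "(P t * ri) * B \<le> W t * B / m"
        unfolding rn_def ri_def
        using mult_right_mono[OF Pn[OF that(2,1)] B] mult_right_mono[OF Pinf[OF that(2)] B]
        by simp_all
      ultimately have "\<bar>E n t\<bar> \<le> W t * B / m + 2 * (W t * B / m)"
        by (smt (verit, ccfv_threshold))
      then show ?thesis by (simp add: mult.commute)
    qed
    have E_lim: "(\<lambda>n. E n t) \<longlonglongrightarrow> 0" for t
    proof -
      have "(\<lambda>n. E n t) \<longlonglongrightarrow> P t * (norm (rGamma (- \<gamma> t) - rGamma (- \<gamma> t)) * B + norm (rGamma (- \<gamma> t)) * (0 / c))"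
        unfolding E_def using c by (intro tendsto_intros rGamma_quotient_LIMSEQ residue_error_LIMSEQ A0) auto
      then show ?thesis by simp
    qed
    have meas: "F n p \<in> borel_measurable M" "E n \<in> borel_measurable M" for n p
      unfolding F_def E_def P_def by measurable
    have Wint: "integrable M (\<lambda>t. 3 * (W t * B / m))" using W by simp
    show ?thesis
      using UL[OF meas(1) Gint meas(2) Wint diff E_le E_lim] by blast
  qed
  have **: "uniform_limit (X \<times> Y) (\<lambda>n p. LINT t|M. F n p t) (\<lambda>p. LINT t|M. G p t) sequentially"
    by (cases "X = {}") (use * in \<open>auto simp: uniform_limit_iff\<close>)
  show "uniform_limit (X \<times> Y) (\<lambda>n (x, y). LINT t|M. ginibre_integrand \<nu> q r n x y (\<gamma> t))
      (\<lambda>(x, y). LINT t|M. hard_edge_integrand \<nu> q r x y (\<gamma> t)) sequentially"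
    using ** by (simp add: F_def G_def case_prod_unfold)
  show "integrable M (\<lambda>t. hard_edge_integrand \<nu> q r x y (\<gamma> t))" if "x \<in> X" "y \<in> Y" for x y
    using Gint[of "(x, y)"] that by (simp add: G_def)
  show "integrable M (\<lambda>t. ginibre_integrand \<nu> q r n x y (\<gamma> t))" if "x \<in> X" "y \<in> Y" "n \<ge> 1" for x y n
  proof -
    have "integrable M (F n (x, y))" using * that by blast
    then show ?thesis by (simp add: F_def)
  qed
qed

section \<open>Convergence along the contour of \<open>\<sigma>\<close>\<close>

text \<open>
  At least one Gamma factor is needed here, which is where \<open>r \<ge> 1\<close> enters.
\<close>
lemma Gamma_product_left_decay:
  assumes K: "K \<ge> 1" and \<delta>: "\<delta> > 0" and r: "r \<ge> 1"
  shows "\<exists>C>0. \<forall>\<sigma>. \<bar>Im \<sigma>\<bar> = \<delta> \<longrightarrow> Re \<sigma> \<le> 0 \<longrightarrow> norm (Gamma_product \<nu> r \<sigma>) \<le> C * K powr Re \<sigma>"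
proof -
  have single: "\<exists>C>0. \<forall>\<sigma>. \<bar>Im \<sigma>\<bar> = \<delta> \<longrightarrow> Re \<sigma> \<le> 0 \<longrightarrow> norm (Gamma (\<sigma> + of_nat (\<nu> j))) \<le> C * K powr Re \<sigma>" for j
  proof -
    obtain C where C: "C > 0" "\<And>z::complex. \<bar>Im z\<bar> = \<delta> \<Longrightarrow> Re z \<le> real (\<nu> j) \<Longrightarrow> norm (Gamma z) \<le> C * K powr Re z"
      using Gamma_left_decay[of K \<delta> "real (\<nu> j)"] K \<delta> by auto
    have "norm (Gamma (\<sigma> + of_nat (\<nu> j))) \<le> (C * K powr real (\<nu> j)) * K powr Re \<sigma>"
      if "\<bar>Im \<sigma>\<bar> = \<delta>" "Re \<sigma> \<le> 0" for \<sigma>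
      using C(2)[of "\<sigma> + of_nat (\<nu> j)"] that by (simp add: powr_add mult_ac)
    then show ?thesis using C(1) K by (intro exI[of _ "C * K powr real (\<nu> j)"]) auto
  qed
  show ?thesis using r
  proof (induction r rule: dec_induct)
    case base
    then show ?case using single[of 1] by (simp add: Gamma_product_def)
  next
    case (step r)
    obtain C where C: "C > 0" "\<And>\<sigma>. \<bar>Im \<sigma>\<bar> = \<delta> \<Longrightarrow> Re \<sigma> \<le> 0 \<Longrightarrow> norm (Gamma_product \<nu> r \<sigma>) \<le> C * K powr Re \<sigma>"
      using step.IH by blast
    obtain D where D: "D > 0" "\<And>\<sigma>. \<bar>Im \<sigma>\<bar> = \<delta> \<Longrightarrow> Re \<sigma> \<le> 0 \<Longrightarrow>
        norm (Gamma (\<sigma> + of_nat (\<nu> (Suc r)))) \<le> D * K powr Re \<sigma>"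
      using single[of "Suc r"] by blast
    have "norm (Gamma_product \<nu> (Suc r) \<sigma>) \<le> (C * D) * K powr Re \<sigma>"
      if \<sigma>: "\<bar>Im \<sigma>\<bar> = \<delta>" "Re \<sigma> \<le> 0" for \<sigma>
    proof -
      have "K powr Re \<sigma> \<le> K powr 0" using K \<sigma> by (intro powr_mono) auto
      then have "D * K powr Re \<sigma> \<le> D" using D(1) K by (auto simp: mult_le_cancel_left1 split: if_splits)
      then have "norm (Gamma (\<sigma> + of_nat (\<nu> (Suc r)))) \<le> D" using D(2)[OF \<sigma>] by linarith
      then have "norm (Gamma_product \<nu> r \<sigma>) * norm (Gamma (\<sigma> + of_nat (\<nu> (Suc r)))) \<le> (C * K powr Re \<sigma>) * D"
        using C(1) C(2)[OF \<sigma>] K by (intro mult_mono) auto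
      then show ?thesis by (simp add: Gamma_product_def norm_mult mult_ac)
    qed
    then show ?case using C(1) D(1) by (intro exI[of _ "C * D"]) auto
  qed
qed

text \<open>
  Let \<open>u = - Re \<sigma>\<close>. Up to constants, Euler's product contributes at most \<open>exp (3 u)\<close> and the power of \<open>y\<close> at most \<open>A\<^bsup>u\<^esup>\<close>. The
  Gamma factors beat both when their decay rate is taken as \<open>K = exp 4 * A\<close>, which leaves \<open>exp (- u)\<close>.
\<close>
lemma sigma_factor_bound_on_rays:
  assumes A: "A \<ge> 1" and \<delta>: "\<delta> > 0" and r: "r \<ge> 1"
  shows "\<exists>C. \<forall>\<sigma> n. n \<ge> 1 \<longrightarrow> \<bar>Im \<sigma>\<bar> = \<delta> \<longrightarrow> Re \<sigma> \<le> 0 \<longrightarrow>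
    norm (Gamma_product \<nu> r \<sigma>) * norm (rGamma_quotient (- \<sigma>) n) * A powr (- Re \<sigma>) \<le> C * exp (Re \<sigma>)"
proof -
  define K where "K = exp 4 * A"
  have "1 * 1 \<le> K" unfolding K_def using A by (intro mult_mono) auto
  then have K: "K \<ge> 1" by simp
  obtain C where C: "C > 0" "\<And>\<sigma>. \<bar>Im \<sigma>\<bar> = \<delta> \<Longrightarrow> Re \<sigma> \<le> 0 \<Longrightarrow> norm (Gamma_product \<nu> r \<sigma>) \<le> C * K powr Re \<sigma>"
    using Gamma_product_left_decay[OF K \<delta> r] by blast
  define D where "D = exp (\<delta> + 2 * \<delta>\<^sup>2)"
  have "norm (Gamma_product \<nu> r \<sigma>) * norm (rGamma_quotient (- \<sigma>) n) * A powr (- Re \<sigma>) \<le> (C * D) * exp (Re \<sigma>)"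
    if n: "n \<ge> 1" and \<sigma>: "\<bar>Im \<sigma>\<bar> = \<delta>" "Re \<sigma> \<le> 0" for \<sigma> n
  proof -
    have "norm (rGamma_quotient (- \<sigma>) n) \<le> norm (- \<sigma>) * exp (2 * (Re (- \<sigma>) + (Im (- \<sigma>))\<^sup>2))"
      using n \<sigma> by (intro norm_rGamma_quotient_le) auto
    also have "\<dots> \<le> exp (- Re \<sigma> + \<delta>) * exp (2 * (- Re \<sigma> + \<delta>\<^sup>2))"
    proof (rule mult_mono)
      have "norm (- \<sigma>) \<le> - Re \<sigma> + \<delta>" using cmod_le[of \<sigma>] \<sigma> by simp
      also have "\<dots> \<le> exp (- Re \<sigma> + \<delta>)" using exp_ge_add_one_self[of "- Re \<sigma> + \<delta>"] by linarith
      finally show "norm (- \<sigma>) \<le> exp (- Re \<sigma> + \<delta>)" .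
      have "(Im (- \<sigma>))\<^sup>2 = \<delta>\<^sup>2" using \<sigma>(1) by (metis power2_abs power2_minus uminus_complex.simps(2))
      then show "exp (2 * (Re (- \<sigma>) + (Im (- \<sigma>))\<^sup>2)) \<le> exp (2 * (- Re \<sigma> + \<delta>\<^sup>2))" by simp
    qed auto
    also have "\<dots> = D * exp (- 3 * Re \<sigma>)" by (simp add: D_def algebra_simps flip: exp_add)
    finally have q: "norm (rGamma_quotient (- \<sigma>) n) \<le> D * exp (- 3 * Re \<sigma>)" .
    have "norm (Gamma_product \<nu> r \<sigma>) * norm (rGamma_quotient (- \<sigma>) n) * A powr (- Re \<sigma>) \<le>
        (C * K powr Re \<sigma>) * (D * exp (- 3 * Re \<sigma>)) * A powr (- Re \<sigma>)"
      using q C(1) C(2)[OF \<sigma>] by (intro mult_mono mult_nonneg_nonneg) (auto simp: D_def)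
    also have "K powr Re \<sigma> = exp (4 * Re \<sigma>) * A powr Re \<sigma>"
      unfolding K_def powr_mult by (simp add: powr_def mult.commute)
    also have "(C * (exp (4 * Re \<sigma>) * A powr Re \<sigma>)) * (D * exp (- 3 * Re \<sigma>)) * A powr (- Re \<sigma>)
        = (C * D) * (exp (4 * Re \<sigma>) * exp (- 3 * Re \<sigma>)) * (A powr Re \<sigma> * A powr (- Re \<sigma>))"
      by (simp only: mult_ac)
    also have "\<dots> = (C * D) * exp (Re \<sigma>)"
      using A by (simp flip: exp_add powr_add)
    finally show ?thesis .
  qed
  then show ?thesis by blast
qed

lemma sigma_factor_bound_on_segment:
  assumes c: "0 < c" "c < 1" and \<nu>: "\<And>j. j \<ge> 1 \<Longrightarrow> \<nu> j \<ge> 1"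
  shows "\<exists>C. \<forall>\<sigma> n. n \<ge> 1 \<longrightarrow> Re \<sigma> = - c \<longrightarrow> \<bar>Im \<sigma>\<bar> \<le> \<delta> \<longrightarrow>
    norm (Gamma_product \<nu> r \<sigma>) * norm (rGamma_quotient (- \<sigma>) n) * A powr (- Re \<sigma>) \<le> C"
proof -
  define S where "S = cbox (Complex (- c) (- \<delta>)) (Complex (- c) \<delta>)"
  have "continuous_on S (Gamma_product \<nu> r)"
    unfolding Gamma_product_def[abs_def]
  proof (intro continuous_on_prod continuous_on_compose2[OF continuous_on_Gamma[of "{z. Re z > 0}"]])
    fix j assume "j \<in> {1..r}"
    then have "\<nu> j \<ge> 1" using \<nu> by simp
    then show "(\<lambda>\<sigma>. \<sigma> + of_nat (\<nu> j)) ` S \<subseteq> {z. 0 < Re z}"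
      using c by (auto simp: S_def in_cbox_complex_iff)
  qed (auto intro!: continuous_intros elim!: nonpos_Ints_cases)
  then have "compact (Gamma_product \<nu> r ` S)"
    by (rule compact_continuous_image) (simp add: S_def)
  then obtain C where C: "C > 0" "\<And>z. z \<in> S \<Longrightarrow> norm (Gamma_product \<nu> r z) \<le> C"
    using compact_imp_bounded bounded_pos by (metis imageI)
  have "norm (Gamma_product \<nu> r \<sigma>) * norm (rGamma_quotient (- \<sigma>) n) * A powr (- Re \<sigma>) \<le>
      C * ((c + \<delta>) * exp (2 * (c + \<delta>\<^sup>2))) * A powr c"
    if n: "n \<ge> 1" and \<sigma>: "Re \<sigma> = - c" "\<bar>Im \<sigma>\<bar> \<le> \<delta>" for \<sigma> n
  proof -
    have "norm (rGamma_quotient (- \<sigma>) n) \<le> norm (- \<sigma>) * exp (2 * (Re (- \<sigma>) + (Im (- \<sigma>))\<^sup>2))"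
      using n \<sigma> c by (intro norm_rGamma_quotient_le) auto
    also have "\<dots> \<le> (c + \<delta>) * exp (2 * (c + \<delta>\<^sup>2))"
    proof (rule mult_mono)
      show "norm (- \<sigma>) \<le> c + \<delta>" using cmod_le[of \<sigma>] \<sigma> c by simp
      have "(Im \<sigma>)\<^sup>2 \<le> \<delta>\<^sup>2" using \<sigma>(2) by (metis abs_ge_zero power2_abs power_mono)
      then show "exp (2 * (Re (- \<sigma>) + (Im (- \<sigma>))\<^sup>2)) \<le> exp (2 * (c + \<delta>\<^sup>2))" using \<sigma> by simp
    qed (use \<sigma> c in auto)
    finally have q: "norm (rGamma_quotient (- \<sigma>) n) \<le> (c + \<delta>) * exp (2 * (c + \<delta>\<^sup>2))" .
    have "\<sigma> \<in> S" using \<sigma> by (auto simp: S_def in_cbox_complex_iff abs_le_iff)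
    from mult_mono[OF C(2)[OF this] q] C(1)
    have "norm (Gamma_product \<nu> r \<sigma>) * norm (rGamma_quotient (- \<sigma>) n) \<le> C * ((c + \<delta>) * exp (2 * (c + \<delta>\<^sup>2)))"
      by simp
    then have "norm (Gamma_product \<nu> r \<sigma>) * norm (rGamma_quotient (- \<sigma>) n) * A powr c \<le>
        C * ((c + \<delta>) * exp (2 * (c + \<delta>\<^sup>2))) * A powr c"
      by (rule mult_right_mono) simp
    then show ?thesis using \<sigma>(1) by simp
  qed
  then show ?thesis by blast
qed

lemma contour_integral_linepath_eq_LINT:
  assumes "integrable (restrict_space lborel {0..1}) (\<lambda>t. f (linepath a b t))"
  shows "contour_integral (linepath a b) f = (LINT t|restrict_space lborel {0..1}. f (linepath a b t)) * (b - a)"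
proof -
  have int: "set_integrable lborel {0..1} (\<lambda>t. f (linepath a b t))"
    using assms by (simp add: integrable_restrict_space set_integrable_def)
  have "(LINT t|restrict_space lborel {0..1}. f (linepath a b t)) = (LINT t:{0..1}|lborel. f (linepath a b t))"
    by (simp add: integral_restrict_space set_lebesgue_integral_def)
  also have "\<dots> = integral {0..1} (\<lambda>t. f (linepath a b t))"
    by (rule set_borel_integral_eq_integral(2)[OF int])
  finally show ?thesis
    by (simp add: contour_integral_integral)
qed

text \<open>
  Each of the three pieces of the contour is an integral over an interval; the dominating functions are a
  multiple of \<open>exp (- t)\<close> on the two rays and a constant on the segment.
\<close>
lemma S_sigma_integral_uniform_limit:
  assumes \<nu>: "\<And>j. j \<ge> 1 \<Longrightarrow> \<nu> j \<ge> 1" and r: "r \<ge> 1"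
    and c: "0 < c" "c < 1" and \<delta>: "0 < \<delta>"
    and X: "X \<subseteq> {0..A}" and Y: "Y \<subseteq> {m..A'}" and m: "0 < m" and A': "1 \<le> A'"
  shows "uniform_limit (X \<times> Y) (\<lambda>n (x, y). S_sigma_integral c \<delta> (ginibre_integrand \<nu> q r n x y))
      (\<lambda>(x, y). S_sigma_integral c \<delta> (hard_edge_integrand \<nu> q r x y)) sequentially"
proof -
  define a b where "a = Complex (- c) (- \<delta>)" and "b = Complex (- c) \<delta>"
  have ray: "uniform_limit (X \<times> Y) (\<lambda>n (x, y). ray_integral p (-1) (ginibre_integrand \<nu> q r n x y))
      (\<lambda>(x, y). ray_integral p (-1) (hard_edge_integrand \<nu> q r x y)) sequentially"
    if p: "Re p = - c" "\<bar>Im p\<bar> = \<delta>" for p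
  proof -
    define M where "M = restrict_space lborel {0::real..}"
    obtain C where C: "\<And>\<sigma> n. n \<ge> 1 \<Longrightarrow> \<bar>Im \<sigma>\<bar> = \<delta> \<Longrightarrow> Re \<sigma> \<le> 0 \<Longrightarrow>
      norm (Gamma_product \<nu> r \<sigma>) * norm (rGamma_quotient (- \<sigma>) n) * A' powr (- Re \<sigma>) \<le> C * exp (Re \<sigma>)"
      using sigma_factor_bound_on_rays[OF A' \<delta> r] by blast
    have "uniform_limit (X \<times> Y) (\<lambda>n (x, y). LINT t|M. ginibre_integrand \<nu> q r n x y (p + of_real t * - 1))
      (\<lambda>(x, y). LINT t|M. hard_edge_integrand \<nu> q r x y (p + of_real t * - 1)) sequentially"
    proof (rule sigma_integrals_uniform_limit(1)[OF \<nu> _ _ c(1) X Y m, where W = "\<lambda>t. C * exp (- c) * exp (- t)"])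
      show "(\<lambda>t. p + of_real t * - 1) \<in> borel_measurable M"
        unfolding M_def by (intro measurable_restrict_space1) measurable
      show "integrable M (\<lambda>t. C * exp (- c) * exp (- t))"
        using set_integrable_exp_uminus
        unfolding M_def by (simp add: integrable_restrict_space set_integrable_def)
      fix t assume t: "t \<in> space M"
      then show "Re (p + of_real t * - 1) \<le> - c" using p by (simp add: M_def space_restrict_space)
      fix n :: nat assume "n \<ge> 1"
      with C[of n "p + of_real t * - 1"] p c t
      show "norm (Gamma_product \<nu> r (p + of_real t * - 1)) * norm (rGamma_quotient (- (p + of_real t * - 1)) n) *
          A' powr - Re (p + of_real t * - 1) \<le> C * exp (- c) * exp (- t)"
        by (simp add: M_def space_restrict_space mult.assoc flip: exp_add)
    qed
    then have "uniform_limit (X \<times> Y) (\<lambda>n p'. - (case p' of (x, y) \<Rightarrow> LINT t|M. ginibre_integrand \<nu> q r n x y (p + of_real t * - 1)))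
      (\<lambda>p'. - (case p' of (x, y) \<Rightarrow> LINT t|M. hard_edge_integrand \<nu> q r x y (p + of_real t * - 1))) sequentially"
      by (rule uniform_limit_uminus)
    then show ?thesis
      by (simp add: ray_integral_def M_def integral_restrict_space set_lebesgue_integral_def case_prod_unfold)
  qed
  have segment: "uniform_limit (X \<times> Y) (\<lambda>n (x, y). contour_integral (linepath a b) (ginibre_integrand \<nu> q r n x y))
      (\<lambda>(x, y). contour_integral (linepath a b) (hard_edge_integrand \<nu> q r x y)) sequentially"
  proof -
    define M where "M = restrict_space lborel {0..1::real}"
    obtain C where C: "\<And>\<sigma> n. n \<ge> 1 \<Longrightarrow> Re \<sigma> = - c \<Longrightarrow> \<bar>Im \<sigma>\<bar> \<le> \<delta> \<Longrightarrow>
      norm (Gamma_product \<nu> r \<sigma>) * norm (rGamma_quotient (- \<sigma>) n) * A' powr (- Re \<sigma>) \<le> C"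
      using sigma_factor_bound_on_segment[where \<nu> = \<nu> and \<delta> = \<delta> and r = r and A = A', OF c \<nu>] by blast
    have seg: "Re (linepath a b t) = - c \<and> \<bar>Im (linepath a b t)\<bar> \<le> \<delta>" if "t \<in> space M" for t
    proof -
      have t: "0 \<le> t" "t \<le> 1" using that by (auto simp: M_def space_restrict_space)
      have "Re (linepath a b t) = - c" by (simp add: linepath_def a_def b_def algebra_simps)
      moreover have "Im (linepath a b t) = (2 * t - 1) * \<delta>" by (simp add: linepath_def a_def b_def algebra_simps)
      moreover have "\<bar>2 * t - 1\<bar> * \<delta> \<le> 1 * \<delta>" using t \<delta> by (intro mult_right_mono) auto
      ultimately show ?thesis using \<delta> by (simp add: abs_mult)
    qed
    have *: "(\<lambda>t. linepath a b t) \<in> borel_measurable M"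
      unfolding M_def linepath_def by (intro measurable_restrict_space1) measurable
    have W: "integrable M (\<lambda>t. C)"
      unfolding M_def by (simp add: integrable_restrict_space)
    note UL = sigma_integrals_uniform_limit[where \<nu> = \<nu> and r = r and q = q and M = M
        and \<gamma> = "\<lambda>t. linepath a b t", OF \<nu> * _ c(1) X Y m W]
    have UL1: "uniform_limit (X \<times> Y) (\<lambda>n (x, y). LINT t|M. ginibre_integrand \<nu> q r n x y (linepath a b t))
      (\<lambda>(x, y). LINT t|M. hard_edge_integrand \<nu> q r x y (linepath a b t)) sequentially"
      using seg C by (intro UL(1)) auto
    have UL2: "integrable M (\<lambda>t. ginibre_integrand \<nu> q r n x y (linepath a b t))"
      if "x \<in> X" "y \<in> Y" "n \<ge> 1" for n x y
      using seg C that by (intro UL(2)) auto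
    have UL3: "integrable M (\<lambda>t. hard_edge_integrand \<nu> q r x y (linepath a b t))"
      if "x \<in> X" "y \<in> Y" for x y
      using seg C that by (intro UL(3)) auto
    have "uniform_limit (X \<times> Y)
      (\<lambda>n p. (case p of (x, y) \<Rightarrow> LINT t|M. ginibre_integrand \<nu> q r n x y (linepath a b t)) * (b - a))
      (\<lambda>p. (case p of (x, y) \<Rightarrow> LINT t|M. hard_edge_integrand \<nu> q r x y (linepath a b t)) * (b - a)) sequentially"
      by (intro bounded_linear.uniform_limit[OF bounded_linear_mult_left] UL1)
    then show ?thesis
    proof (rule uniform_limit_cong[THEN iffD1, rotated 2])
      show "\<forall>\<^sub>F n in sequentially. \<forall>p\<in>X \<times> Y.
          (case p of (x, y) \<Rightarrow> LINT t|M. ginibre_integrand \<nu> q r n x y (linepath a b t)) * (b - a) =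
          (case p of (x, y) \<Rightarrow> contour_integral (linepath a b) (ginibre_integrand \<nu> q r n x y))"
        using eventually_ge_at_top[of 1]
      proof eventually_elim
        case (elim n)
        show ?case
          using contour_integral_linepath_eq_LINT[OF UL2[unfolded M_def]] elim by (auto simp: M_def)
      qed
      show "(case p of (x, y) \<Rightarrow> LINT t|M. hard_edge_integrand \<nu> q r x y (linepath a b t)) * (b - a) =
          (case p of (x, y) \<Rightarrow> contour_integral (linepath a b) (hard_edge_integrand \<nu> q r x y))"
        if "p \<in> X \<times> Y" for p
        using contour_integral_linepath_eq_LINT[OF UL3[unfolded M_def]] that by (auto simp: M_def)
    qed
  qed
  have "uniform_limit (X \<times> Y)
     (\<lambda>n p. - (case p of (x, y) \<Rightarrow> ray_integral a (-1) (ginibre_integrand \<nu> q r n x y)) +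
       (case p of (x, y) \<Rightarrow> contour_integral (linepath a b) (ginibre_integrand \<nu> q r n x y)) +
       (case p of (x, y) \<Rightarrow> ray_integral b (-1) (ginibre_integrand \<nu> q r n x y)))
     (\<lambda>p. - (case p of (x, y) \<Rightarrow> ray_integral a (-1) (hard_edge_integrand \<nu> q r x y)) +
       (case p of (x, y) \<Rightarrow> contour_integral (linepath a b) (hard_edge_integrand \<nu> q r x y)) +
       (case p of (x, y) \<Rightarrow> ray_integral b (-1) (hard_edge_integrand \<nu> q r x y))) sequentially"
    using \<delta> by (intro uniform_limit_add uniform_limit_uminus ray segment) (auto simp: a_def b_def)
  then show ?thesis
    by (simp add: S_sigma_integral_def hook_integral_def a_def b_def case_prod_unfold)
qed

section \<open>The integrals over \<open>\<zeta>\<close> as residue sums\<close>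

lemma Gamma_arguments_not_nonpos_Int:
  fixes \<zeta> :: complex
  assumes "\<zeta> \<notin> range of_nat" "- 1 < Re \<zeta>"
  shows "\<zeta> - of_nat n + 1 \<notin> \<int>\<^sub>\<le>\<^sub>0" and "- \<zeta> \<notin> \<int>\<^sub>\<le>\<^sub>0"
proof -
  have *: "\<zeta> \<noteq> of_int i" for i
  proof
    assume i: "\<zeta> = of_int i"
    then have "i \<ge> 0" using assms(2) by simp
    then have "\<zeta> = of_nat (nat i)" using i by simp
    then show False using assms(1) by blast
  qed
  show "\<zeta> - of_nat n + 1 \<notin> \<int>\<^sub>\<le>\<^sub>0"
  proof
    assume "\<zeta> - of_nat n + 1 \<in> \<int>\<^sub>\<le>\<^sub>0"
    then obtain i where "\<zeta> - of_nat n + 1 = of_int i" by (auto elim: nonpos_Ints_cases)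
    then have "\<zeta> = of_int (i + int n - 1)" by (simp add: algebra_simps)
    then show False using * by blast
  qed
  show "- \<zeta> \<notin> \<int>\<^sub>\<le>\<^sub>0"
  proof
    assume "- \<zeta> \<in> \<int>\<^sub>\<le>\<^sub>0"
    then obtain i where "- \<zeta> = of_int i" by (auto elim: nonpos_Ints_cases)
    then have "\<zeta> = of_int (- i)" by (simp add: minus_equation_iff[of \<zeta>])
    then show False using * by blast
  qed
qed

lemma powr_divide_of_nat:
  assumes "y > 0" "n \<ge> 1"
  shows "of_real (y / real n) powr s = of_real y powr s * of_nat n powr (- s :: complex)"
proof -
  have Ln: "Ln (of_real y / of_nat n) = of_real (ln y) - of_real (ln (real n))"
    using assms Ln_of_real[of "y / real n"] by (auto simp: ln_div)
  have "Ln (of_real y) = of_real (ln y)" "Ln (of_nat n) = of_real (ln (real n))"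
    using assms Ln_of_real[of "real n"] by (auto simp: Ln_of_real)
  then show ?thesis
    using assms by (simp add: powr_def Ln right_diff_distrib exp_diff exp_minus) (simp add: divide_inverse)
qed

lemma Gamma_ratio_eq_rGamma_quotient:
  assumes n: "n \<ge> 1" and \<sigma>: "\<sigma> \<notin> \<int>"
  shows "Gamma (\<sigma> + 1) / Gamma (\<sigma> - of_nat n + 1) =
    (-1) ^ n * fact (n - 1) * of_nat n powr (- \<sigma>) * rGamma_quotient (- \<sigma>) n"
proof -
  have "\<sigma> - of_nat n + 1 \<notin> \<int>\<^sub>\<le>\<^sub>0"
  proof
    assume "\<sigma> - of_nat n + 1 \<in> \<int>\<^sub>\<le>\<^sub>0"
    then obtain i where "\<sigma> - of_nat n + 1 = of_int i" by (auto elim: nonpos_Ints_cases)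
    then have "\<sigma> = of_int (i + int n - 1)" by (simp add: algebra_simps)
    then show False using \<sigma> by (metis Ints_of_int)
  qed
  from pochhammer_Gamma[OF this, of n]
  have "Gamma (\<sigma> + 1) / Gamma (\<sigma> - of_nat n + 1) = pochhammer (\<sigma> - of_nat n + 1) n" by simp
  also have "\<dots> = (-1) ^ n * pochhammer (- \<sigma>) n"
    using pochhammer_minus[of \<sigma> n] by (simp flip: power_mult_distrib)
  finally show ?thesis using n by (simp add: rGamma_quotient_def)
qed

text \<open>
  Since \<open>\<nu> 0 = 1\<close>, the factors with index \<open>0\<close> combine with the two Gamma functions depending on \<open>n\<close> into
  \<open>\<Gamma>(\<sigma> + 1) / \<Gamma>(\<sigma> - n + 1)\<close> and \<open>\<Gamma>(\<zeta> - n + 1) / \<Gamma>(\<zeta> + 1)\<close>. The former is Euler's product up to powers of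
  \<open>n\<close>, and the latter has simple poles exactly at \<open>0, \<dots>, n - 1\<close>.
\<close>
lemma ginibre_inner_integral:
  assumes \<nu>0: "\<nu> 0 = 1" and n: "n \<ge> 1" and c: "0 < c" "c < 1"
    and rect: "S_zeta_rectangle c n a b"
    and \<sigma>: "Re \<sigma> \<le> - c" "\<sigma> \<notin> \<int>" and x: "x > 0" and y: "y > 0"
  shows "contour_integral (rectpath a b) (\<lambda>\<zeta>.
         (\<Prod>j=0..r. Gamma (\<sigma> + of_nat (\<nu> j))) / (\<Prod>j=0..q. Gamma (\<zeta> + of_nat (\<nu> j))) *
         (Gamma (\<zeta> - of_nat n + 1) / Gamma (\<sigma> - of_nat n + 1)) *
         (of_real (x / real n) powr \<zeta> * of_real (y / real n) powr (- \<sigma> - 1) / (\<sigma> - \<zeta>)))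
       / (2 * of_real pi * \<i>) = of_nat n * ginibre_integrand \<nu> q r n x y \<sigma>"
proof -
  define S where "S = {z :: complex. - c < Re z}"
  have S: "open S" "of_nat k \<in> S" for k using c by (auto simp: S_def open_halfspace_Re_gt)
  define D where "D = (\<Prod>j=0..r. Gamma (\<sigma> + of_nat (\<nu> j))) / Gamma (\<sigma> - of_nat n + 1) *
      of_real (y / real n) powr (- \<sigma> - 1)"
  define g where "g = (\<lambda>\<zeta>. D * (\<Prod>j=1..q. rGamma (\<zeta> + of_nat (\<nu> j))) * of_real (x / real n) powr \<zeta> / (\<sigma> - \<zeta>))"
  define f where "f = (\<lambda>\<zeta>. Gamma (\<zeta> - of_nat n + 1) * rGamma (\<zeta> + 1) * g \<zeta>)"
  have eq: "(\<lambda>\<zeta>. (\<Prod>j=0..r. Gamma (\<sigma> + of_nat (\<nu> j))) / (\<Prod>j=0..q. Gamma (\<zeta> + of_nat (\<nu> j))) *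
         (Gamma (\<zeta> - of_nat n + 1) / Gamma (\<sigma> - of_nat n + 1)) *
         (of_real (x / real n) powr \<zeta> * of_real (y / real n) powr (- \<sigma> - 1) / (\<sigma> - \<zeta>))) = f"
  proof
    fix \<zeta> :: complex
    have "inverse (\<Prod>j=0..q. Gamma (\<zeta> + of_nat (\<nu> j))) = rGamma (\<zeta> + 1) * (\<Prod>j=1..q. rGamma (\<zeta> + of_nat (\<nu> j)))"
      using \<nu>0 by (simp add: prod.atLeast_Suc_atMost rGamma_inverse_Gamma prod_inversef[symmetric])
    then show "(\<Prod>j=0..r. Gamma (\<sigma> + of_nat (\<nu> j))) / (\<Prod>j=0..q. Gamma (\<zeta> + of_nat (\<nu> j))) *
         (Gamma (\<zeta> - of_nat n + 1) / Gamma (\<sigma> - of_nat n + 1)) *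
         (of_real (x / real n) powr \<zeta> * of_real (y / real n) powr (- \<sigma> - 1) / (\<sigma> - \<zeta>)) = f \<zeta>"
      by (simp add: f_def g_def D_def divide_inverse mult_ac)
  qed
  have g: "g holomorphic_on S"
    unfolding g_def using \<sigma> x n by (intro holomorphic_intros) (auto simp: S_def)
  have f: "f holomorphic_on S - range of_nat"
    unfolding f_def
  proof (intro holomorphic_intros)
    show "g holomorphic_on S - range of_nat" using g by (rule holomorphic_on_subset) auto
    show "\<zeta> - of_nat n + 1 \<notin> \<int>\<^sub>\<le>\<^sub>0" if "\<zeta> \<in> S - range of_nat" for \<zeta>
      using that c by (intro Gamma_arguments_not_nonpos_Int) (auto simp: S_def)
  qed
  have residue_f: "residue f (of_nat k) = (-1) ^ n * D / fact (n - 1) *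
      (of_real (falling_ratio n k) * residue_coeff \<nu> q x k / (\<sigma> - of_nat k))" if "k < n" for k
  proof -
    have pow: "of_real (x / real n) powr (of_nat k :: complex) = of_real x ^ k / of_nat n ^ k"
      using x n by (simp add: powr_nat' power_divide)
    have "real ((n - 1) choose k) * fact k = fact (n - 1) / fact (n - 1 - k)"
      using binomial_fact[of k "n - 1", where 'a = real] that by (simp add: field_simps)
    then have "falling_ratio n k = fact (n - 1) / fact (n - 1 - k) / real n ^ k"
      by (simp add: falling_ratio_def)
    then have ratio: "of_real (falling_ratio n k) = (fact (n - 1) / fact (n - 1 - k) / of_nat n ^ k :: complex)"
      by simp
    have "residue f (of_nat k) = (-1) ^ n * (- ((-1) ^ k) / (fact k * fact (n - 1 - k))) * g (of_nat k)"
      unfolding f_def by (rule residue_Gamma_ratio[OF g S that])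
    also have "\<dots> = (-1) ^ n * D / fact (n - 1) *
      (of_real (falling_ratio n k) * residue_coeff \<nu> q x k / (\<sigma> - of_nat k))"
      unfolding ratio residue_coeff_def g_def pow by (simp add: mult_ac)
    finally show ?thesis .
  qed
  have "contour_integral (rectpath a b) f / (2 * of_real pi * \<i>) = (\<Sum>k<n. residue f (of_nat k))"
    using rect n c f by (subst rectpath_integral_eq_sum_residues[of f c])
      (auto simp: S_zeta_rectangle_def S_def)
  also have "\<dots> = (-1) ^ n * D / fact (n - 1) *
      (\<Sum>k<n. of_real (falling_ratio n k) * residue_coeff \<nu> q x k / (\<sigma> - of_nat k))"
    unfolding sum_distrib_left by (intro sum.cong) (use residue_f in auto)
  also have "(\<Sum>k<n. of_real (falling_ratio n k) * residue_coeff \<nu> q x k / (\<sigma> - of_nat k)) =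
      (\<Sum>k. of_real (falling_ratio n k) * residue_coeff \<nu> q x k / (\<sigma> - of_nat k))"
    by (rule suminf_finite[symmetric]) (use n in \<open>auto simp: falling_ratio_def binomial_eq_0\<close>)
  also have "(-1) ^ n * D / fact (n - 1) =
      of_nat n * (Gamma_product \<nu> r \<sigma> * rGamma_quotient (- \<sigma>) n * of_real y powr (- \<sigma> - 1))"
  proof -
    have "(\<Prod>j=0..r. Gamma (\<sigma> + of_nat (\<nu> j))) = Gamma (\<sigma> + 1) * Gamma_product \<nu> r \<sigma>"
      using \<nu>0 by (simp add: prod.atLeast_Suc_atMost Gamma_product_def)
    then have "D = Gamma (\<sigma> + 1) / Gamma (\<sigma> - of_nat n + 1) * Gamma_product \<nu> r \<sigma> *
        of_real (y / real n) powr (- \<sigma> - 1)"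
      by (simp add: D_def)
    also have "of_real (y / real n) powr (- \<sigma> - 1) = of_real y powr (- \<sigma> - 1) * (of_nat n powr \<sigma> * of_nat n)"
      using n by (subst powr_divide_of_nat[OF y n]) (simp add: powr_add)
    also have "Gamma (\<sigma> + 1) / Gamma (\<sigma> - of_nat n + 1) =
        (-1) ^ n * fact (n - 1) * of_nat n powr (- \<sigma>) * rGamma_quotient (- \<sigma>) n"
      by (rule Gamma_ratio_eq_rGamma_quotient[OF n \<sigma>(2)])
    finally have D: "D = (-1) ^ n * fact (n - 1) * (of_nat n powr (- \<sigma>) * of_nat n powr \<sigma>) *
        (of_nat n * (Gamma_product \<nu> r \<sigma> * rGamma_quotient (- \<sigma>) n * of_real y powr (- \<sigma> - 1)))"
      by (simp add: mult_ac)
    have "of_nat n powr (- \<sigma>) * of_nat n powr \<sigma> = 1"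
      using n by (simp flip: powr_add)
    moreover have "(-1) ^ n * (-1) ^ n = (1 :: complex)" by (simp flip: power_mult_distrib)
    ultimately show ?thesis unfolding D by simp
  qed
  finally show ?thesis unfolding eq by (simp add: ginibre_integrand_def mult.assoc)
qed

text \<open>
  By reflection \<open>\<Gamma>(- \<zeta>)\<close> is \<open>1 / \<Gamma>(1 + \<zeta>)\<close> up to the factor \<open>- \<pi> / sin (\<pi> \<zeta>)\<close>. Its decay rate is chosen as
  \<open>K = exp 1 * x\<close>, so that it absorbs \<open>x\<^bsup>\<zeta>\<^esup>\<close> and leaves \<open>exp (- Re \<zeta>)\<close>.
\<close>
lemma hard_edge_zeta_factor_decay:
  fixes q :: nat and c c' \<delta> x :: real
  assumes c: "c' < c" and \<delta>: "\<delta> > 0" and x: "x > 0" and \<sigma>: "Re \<sigma> \<le> - c"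
  shows "\<exists>C\<ge>0. \<forall>\<zeta>. - c' \<le> Re \<zeta> \<longrightarrow> \<bar>Im \<zeta>\<bar> \<le> \<delta> \<longrightarrow> (\<bar>Im \<zeta>\<bar> = \<delta> \<or> (\<exists>n. Re \<zeta> = real n + 1 / 2)) \<longrightarrow>
    norm (Gamma (- \<zeta>) * ((\<Prod>j=1..q. rGamma (\<zeta> + of_nat (\<nu> j))) * of_real x powr \<zeta> / (\<sigma> - \<zeta>))) \<le> C * exp (- Re \<zeta>)"
proof -
  define K where "K = exp 1 * x"
  have K: "K > 0" using x by (simp add: K_def)
  define s where "s = min 1 (sinh (pi * \<delta>))"
  have s: "s > 0" using \<delta> by (simp add: s_def)
  obtain C where C: "C > 0" "\<And>z::complex. \<bar>Im z\<bar> \<le> \<delta> \<Longrightarrow> - \<bar>c'\<bar> \<le> Re z \<Longrightarrow> norm (rGamma z) \<le> C * K powr (- Re z)"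
    using rGamma_strip_decay[OF K, of "\<bar>c'\<bar>" \<delta>] by auto
  obtain C1 where C1: "C1 > 0" "\<And>z::complex. \<bar>Im z\<bar> \<le> \<delta> \<Longrightarrow> - \<bar>c'\<bar> \<le> Re z \<Longrightarrow> norm (rGamma z) \<le> C1"
    using rGamma_strip_decay[of 1 "\<bar>c'\<bar>" \<delta>] by auto
  have "norm (Gamma (- \<zeta>) * ((\<Prod>j=1..q. rGamma (\<zeta> + of_nat (\<nu> j))) * of_real x powr \<zeta> / (\<sigma> - \<zeta>))) \<le>
      (pi / s * (C / K) * (C1 ^ q / (c - c'))) * exp (- Re \<zeta>)"
    if \<zeta>: "- c' \<le> Re \<zeta>" "\<bar>Im \<zeta>\<bar> \<le> \<delta>" "\<bar>Im \<zeta>\<bar> = \<delta> \<or> (\<exists>n. Re \<zeta> = real n + 1 / 2)" for \<zeta>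
  proof -
    have sin: "s \<le> norm (sin (of_real pi * - \<zeta>))"
      using \<zeta>(3)
    proof
      assume "\<bar>Im \<zeta>\<bar> = \<delta>"
      then have "sinh \<bar>pi * Im \<zeta>\<bar> = sinh (pi * \<delta>)" by (simp add: abs_mult)
      then have "sinh (pi * \<delta>) \<le> \<bar>sinh (Im (of_real pi * - \<zeta>))\<bar>"
        by (cases "pi * Im \<zeta> \<ge> 0") auto
      also have "\<dots> \<le> norm (sin (of_real pi * - \<zeta>))" by (rule norm_sin_ge_sinh_Im)
      finally show ?thesis by (simp add: s_def)
    next
      assume "\<exists>n. Re \<zeta> = real n + 1 / 2"
      then obtain n where "Re \<zeta> = real n + 1 / 2" by blast
      then have "1 \<le> norm (sin (of_real pi * \<zeta>))" by (rule norm_sin_half_odd_ge_1)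
      then show ?thesis by (simp add: s_def)
    qed
    have G: "norm (Gamma (- \<zeta>)) \<le> pi / s * (C * K powr (- Re (1 + \<zeta>)))"
    proof -
      have "norm (Gamma (- \<zeta>)) = pi / norm (sin (of_real pi * - \<zeta>)) * norm (rGamma (1 + \<zeta>))"
        using sin s by (subst Gamma_eq_rGamma_reflected) (auto simp: norm_mult norm_divide)
      also have "\<dots> \<le> pi / s * (C * K powr (- Re (1 + \<zeta>)))"
        using sin s C(2)[of "1 + \<zeta>"] \<zeta> by (intro mult_mono frac_le) auto
      finally show ?thesis .
    qed
    have P: "norm (\<Prod>j=1..q. rGamma (\<zeta> + of_nat (\<nu> j))) \<le> C1 ^ q"
    proof -
      have "(\<Prod>j=1..q. norm (rGamma (\<zeta> + of_nat (\<nu> j)))) \<le> (\<Prod>j=1..q. C1)"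
        using \<zeta> by (intro prod_mono) (auto intro!: C1(2))
      then show ?thesis by (simp add: prod_norm)
    qed
    have den: "c - c' \<le> norm (\<sigma> - \<zeta>)"
      using abs_Re_le_cmod[of "\<sigma> - \<zeta>"] \<sigma> \<zeta> by simp
    have "norm (Gamma (- \<zeta>) * ((\<Prod>j=1..q. rGamma (\<zeta> + of_nat (\<nu> j))) * of_real x powr \<zeta> / (\<sigma> - \<zeta>))) =
        norm (Gamma (- \<zeta>)) * (norm (\<Prod>j=1..q. rGamma (\<zeta> + of_nat (\<nu> j))) * x powr Re \<zeta> / norm (\<sigma> - \<zeta>))"
      using x by (simp add: norm_mult norm_divide norm_powr_real_powr)
    also have "\<dots> \<le> (pi / s * (C * K powr (- Re (1 + \<zeta>)))) * (C1 ^ q * x powr Re \<zeta> / (c - c'))"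
      using G P den c s C(1) C1(1) by (intro mult_mono frac_le mult_nonneg_nonneg divide_nonneg_nonneg) auto
    also have "K powr (- Re (1 + \<zeta>)) = exp (- Re \<zeta>) * x powr (- Re \<zeta>) / K"
    proof -
      have "K powr (- Re (1 + \<zeta>)) = K powr (- Re \<zeta>) / K"
        using K by (simp add: powr_diff powr_minus field_simps)
      also have "K powr (- Re \<zeta>) = exp (- Re \<zeta>) * x powr (- Re \<zeta>)"
        unfolding K_def powr_mult by (simp add: powr_def)
      finally show ?thesis .
    qed
    also have "(pi / s * (C * (exp (- Re \<zeta>) * x powr (- Re \<zeta>) / K))) * (C1 ^ q * x powr Re \<zeta> / (c - c')) =
        (pi / s * (C / K) * (C1 ^ q / (c - c'))) * exp (- Re \<zeta>) * (x powr (- Re \<zeta>) * x powr Re \<zeta>)"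
      by (simp add: mult_ac)
    also have "x powr (- Re \<zeta>) * x powr Re \<zeta> = 1" using x by (simp flip: powr_add)
    finally show ?thesis by simp
  qed
  moreover have "pi / s * (C / K) * (C1 ^ q / (c - c')) \<ge> 0" using c s K C(1) C1(1) by auto
  ultimately show ?thesis by blast
qed

lemma hard_edge_inner_integral:
  assumes \<nu>: "\<And>j. j \<ge> 1 \<Longrightarrow> \<nu> j \<ge> 1" and c: "0 < c'" "c' < c" "c < 1" and \<delta>: "0 < \<delta>"
    and \<sigma>: "Re \<sigma> \<le> - c" and x: "x > 0"
  shows "S_zeta_integral c' \<delta> (\<lambda>\<zeta>.
         (\<Prod>j=1..r. Gamma (\<sigma> + of_nat (\<nu> j))) / (\<Prod>j=1..q. Gamma (\<zeta> + of_nat (\<nu> j))) *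
         (Gamma (- \<zeta>) / Gamma (- \<sigma>)) *
         (of_real x powr \<zeta> * of_real y powr (- \<sigma> - 1) / (\<sigma> - \<zeta>)))
       / (2 * of_real pi * \<i>) = hard_edge_integrand \<nu> q r x y \<sigma>"
proof -
  define S where "S = {z :: complex. - c < Re z}"
  have S: "open S" "of_nat k \<in> S" for k using c by (auto simp: S_def open_halfspace_Re_gt)
  define D where "D = Gamma_product \<nu> r \<sigma> * rGamma (- \<sigma>) * of_real y powr (- \<sigma> - 1)"
  define g where "g = (\<lambda>\<zeta>. (\<Prod>j=1..q. rGamma (\<zeta> + of_nat (\<nu> j))) * of_real x powr \<zeta> / (\<sigma> - \<zeta>))"
  define f where "f = (\<lambda>\<zeta>. D * (Gamma (- \<zeta>) * g \<zeta>))"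
  have eq: "(\<lambda>\<zeta>. (\<Prod>j=1..r. Gamma (\<sigma> + of_nat (\<nu> j))) / (\<Prod>j=1..q. Gamma (\<zeta> + of_nat (\<nu> j))) *
         (Gamma (- \<zeta>) / Gamma (- \<sigma>)) *
         (of_real x powr \<zeta> * of_real y powr (- \<sigma> - 1) / (\<sigma> - \<zeta>))) = f"
    by (simp add: fun_eq_iff f_def g_def D_def Gamma_product_def rGamma_inverse_Gamma prod_inversef[symmetric]
        divide_inverse mult_ac)
  have g: "g holomorphic_on S"
    unfolding g_def using \<sigma> x by (intro holomorphic_intros) (auto simp: S_def)
  have f: "f holomorphic_on S - range of_nat"
    unfolding f_def
  proof (intro holomorphic_intros)
    show "g holomorphic_on S - range of_nat" using g by (rule holomorphic_on_subset) auto
    show "- \<zeta> \<notin> \<int>\<^sub>\<le>\<^sub>0" if "\<zeta> \<in> S - range of_nat" for \<zeta>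
      using that c by (intro Gamma_arguments_not_nonpos_Int) (auto simp: S_def)
  qed
  obtain C where C: "C \<ge> 0" "\<And>\<zeta>. - c' \<le> Re \<zeta> \<Longrightarrow> \<bar>Im \<zeta>\<bar> \<le> \<delta> \<Longrightarrow> (\<bar>Im \<zeta>\<bar> = \<delta> \<or> (\<exists>n. Re \<zeta> = real n + 1 / 2)) \<Longrightarrow>
    norm (Gamma (- \<zeta>) * g \<zeta>) \<le> C * exp (- Re \<zeta>)"
    using hard_edge_zeta_factor_decay[where q = q and \<nu> = \<nu>, OF c(2) \<delta> x \<sigma>] unfolding g_def by blast
  have fC: "norm (f \<zeta>) \<le> (norm D * C) * exp (- Re \<zeta>)"
    if "- c' \<le> Re \<zeta>" "\<bar>Im \<zeta>\<bar> \<le> \<delta>" "\<bar>Im \<zeta>\<bar> = \<delta> \<or> (\<exists>n. Re \<zeta> = real n + 1 / 2)" for \<zeta>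
    using mult_left_mono[OF C(2)[OF that], of "norm D"] by (simp add: f_def norm_mult mult.assoc)
  have "(\<lambda>k. 2 * pi * \<i> * residue f (of_nat k)) sums S_zeta_integral c' \<delta> f"
  proof (rule S_zeta_integral_sums_residues)
    show "f holomorphic_on {z. - c < Re z} - range of_nat" using f by (simp add: S_def)
    show "norm (f z) \<le> (norm D * C) * exp (- Re z)" if "- c' \<le> Re z" "\<bar>Im z\<bar> = \<delta>" for z
      using fC that by auto
    show "norm (f z) \<le> (norm D * C) * exp (- Re z)" if "\<bar>Im z\<bar> \<le> \<delta>" "Re z = real n + 1 / 2" for z n
      using that c by (intro fC) auto
  qed (use c \<delta> C(1) in auto)
  moreover have "residue f (of_nat k) = D * (residue_coeff \<nu> q x k / (\<sigma> - of_nat k))" for k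
  proof -
    have "residue f (of_nat k) = residue (\<lambda>\<zeta>. Gamma (- \<zeta>) * (D * g \<zeta>)) (of_nat k)"
      by (simp add: f_def mult_ac)
    also have "\<dots> = - ((-1) ^ k) / fact k * (D * g (of_nat k))"
      by (rule residue_Gamma_uminus[OF _ S]) (intro holomorphic_intros g)
    also have "\<dots> = D * (residue_coeff \<nu> q x k / (\<sigma> - of_nat k))"
      using x by (simp add: residue_coeff_def g_def powr_nat' mult_ac)
    finally show ?thesis .
  qed
  ultimately have "(\<lambda>k. 2 * pi * \<i> * (D * (residue_coeff \<nu> q x k / (\<sigma> - of_nat k)))) sums S_zeta_integral c' \<delta> f"
    by simp
  moreover have "(\<lambda>k. 2 * pi * \<i> * (D * (residue_coeff \<nu> q x k / (\<sigma> - of_nat k)))) sums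
      (2 * pi * \<i> * (D * (\<Sum>k. residue_coeff \<nu> q x k / (\<sigma> - of_nat k))))"
    using residue_series_bounds(1)[where x = x and q = q and \<nu> = \<nu>, OF \<nu> _ order_refl \<sigma>] x c
    by (intro sums_mult summable_sums) auto
  ultimately have "S_zeta_integral c' \<delta> f = 2 * pi * \<i> * (D * (\<Sum>k. residue_coeff \<nu> q x k / (\<sigma> - of_nat k)))"
    by (rule sums_unique2)
  then show ?thesis unfolding eq by (simp add: hard_edge_integrand_def D_def)
qed

section \<open>The hard-edge limit\<close>

text \<open>
  For \<open>0 < c < 1\<close> the contour avoids the integers. This is essential, as the evaluation of the inner Ginibre
  integral divides by \<open>\<Gamma>(\<sigma> - n + 1)\<close>, which vanishes by convention at its poles.
\<close>
lemma S_sigma_integral_cong: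
  assumes c: "0 < c" "c < 1" and \<delta>: "0 < \<delta>"
    and eq: "\<And>\<sigma>. Re \<sigma> \<le> - c \<Longrightarrow> \<sigma> \<notin> \<int> \<Longrightarrow> f \<sigma> = g \<sigma>"
  shows "S_sigma_integral c \<delta> f = S_sigma_integral c \<delta> g"
proof -
  have ray: "ray_integral p (-1) f = ray_integral p (-1) g" if "Re p = - c" "Im p \<noteq> 0" for p
    unfolding ray_integral_def
  proof (intro set_lebesgue_integral_cong allI impI)
    fix t :: real assume "t \<in> {0..}"
    then have "f (p + of_real t * - 1) = g (p + of_real t * - 1)"
      using that by (intro eq) (auto simp: complex_is_Int_iff)
    then show "f (p + of_real t * - 1) * - 1 = g (p + of_real t * - 1) * - 1" by simp
  qed auto
  have "- c \<notin> \<int>"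
  proof
    assume "- c \<in> \<int>"
    then obtain i where "- c = of_int i" by (elim Ints_cases)
    then have "of_int i < (0 :: real)" "of_int (- 1) < (of_int i :: real)" using c by auto
    then have "i < 0" "- 1 < i" unfolding of_int_less_iff by simp_all
    then show False by linarith
  qed
  then have nonint: "\<sigma> \<notin> \<int>" if "Re \<sigma> = - c" for \<sigma>
    using that by (metis Ints_of_int complex_is_Int_iff)
  have "Re \<sigma> = - c" if "\<sigma> \<in> closed_segment (Complex (- c) (- \<delta>)) (Complex (- c) \<delta>)" for \<sigma>
    using that by (simp add: closed_segment_same_Re)
  then have "contour_integral (linepath (Complex (- c) (- \<delta>)) (Complex (- c) \<delta>)) f =
      contour_integral (linepath (Complex (- c) (- \<delta>)) (Complex (- c) \<delta>)) g"
    using nonint by (intro contour_integral_eq eq) auto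
  then show ?thesis
    unfolding S_sigma_integral_def hook_integral_def using \<delta> by (simp add: ray)
qed

lemma S_sigma_integral_mult_left: "S_sigma_integral c \<delta> (\<lambda>\<sigma>. k * f \<sigma>) = k * S_sigma_integral c \<delta> f"
proof -
  have "ray_integral p d (\<lambda>\<sigma>. k * f \<sigma>) = k * ray_integral p d f" for p d
    unfolding ray_integral_def by (simp add: mult.assoc)
  moreover have "contour_integral \<gamma> (\<lambda>\<sigma>. k * f \<sigma>) = k * contour_integral \<gamma> f" for \<gamma>
    unfolding contour_integral_integral by (simp add: mult.assoc)
  ultimately show ?thesis
    unfolding S_sigma_integral_def hook_integral_def by (simp add: algebra_simps)
qed

theorem theorem2p3:
  fixes \<nu> :: "nat \<Rightarrow> nat" and q r :: nat
    and \<kappa> c \<delta> c' :: real and a b :: "nat \<Rightarrow> complex" and X Y :: "real set"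
  assumes "\<nu> 0 = 1"
    and "\<And>j. j \<ge> 1 \<Longrightarrow> \<nu> j \<ge> 1"
    and "q \<ge> 1" and "r \<ge> 1"
    and "\<And>j. q < j \<Longrightarrow> j \<le> r \<Longrightarrow> - (real (\<nu> j) - 1) < \<kappa>"
    and "0 < \<delta>" and "0 < c'" and "c' < c" and "c < 1"
    and "\<And>n. n \<ge> 1 \<Longrightarrow> S_zeta_rectangle c n (a n) (b n)"
    and "compact X" and "X \<subseteq> {0<..}" and "compact Y" and "Y \<subseteq> {0<..}"
  shows "uniform_limit (X \<times> Y)
    (\<lambda>n (x, y). 1 / of_nat n *
       ginibre_kernel \<kappa> c \<delta> (a n) (b n) n \<nu> q (x / real n) r (y / real n))
    (\<lambda>(x, y). hard_edge_kernel \<kappa> c \<delta> c' \<nu> q x r y)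
    sequentially"
proof -
  have c: "0 < c" using assms by simp
  obtain A where A: "X \<subseteq> {0..A}"
  proof -
    obtain A where "\<forall>x\<in>X. norm x \<le> A" using compact_imp_bounded[OF \<open>compact X\<close>] bounded_iff by blast
    then show ?thesis using \<open>X \<subseteq> {0<..}\<close> by (intro that[of A]) force
  qed
  obtain m A' where Y: "Y \<subseteq> {m..A'}" and m: "0 < m" and A': "1 \<le> A'"
  proof (cases "Y = {}")
    case True
    then show ?thesis by (intro that[of 1 1]) auto
  next
    case False
    obtain l where l: "l \<in> Y" "\<forall>y\<in>Y. l \<le> y" using compact_attains_inf[OF \<open>compact Y\<close> False] by blast
    obtain u where u: "\<forall>y\<in>Y. y \<le> u" using compact_attains_sup[OF \<open>compact Y\<close> False] by blast
    show ?thesis using l u \<open>Y \<subseteq> {0<..}\<close> by (intro that[of l "max 1 u"]) (auto simp: le_max_iff_disj)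
  qed
  \<comment> \<open>The transition term is homogeneous of degree \<open>- 1\<close> in \<open>(x, y)\<close>, hence unchanged by the rescaling.\<close>
  define T where "T = (\<lambda>p. kernel_transition \<kappa> \<nu> q (fst p) r (snd p))"
  have ginibre: "1 / of_nat n * ginibre_kernel \<kappa> c \<delta> (a n) (b n) n \<nu> q (x / real n) r (y / real n) =
      kernel_transition \<kappa> \<nu> q x r y + S_sigma_integral c \<delta> (ginibre_integrand \<nu> q r n x y) / (2 * of_real pi * \<i>)"
    if n: "n \<ge> 1" and xy: "x \<in> X" "y \<in> Y" for n x y
  proof -
    have pos: "x > 0" "y > 0" using xy assms by auto
    have "1 / of_nat n * kernel_transition \<kappa> \<nu> q (x / real n) r (y / real n) = kernel_transition \<kappa> \<nu> q x r y"
      using n by (simp add: kernel_transition_def)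
    moreover have "S_sigma_integral c \<delta> (\<lambda>\<sigma>.
       contour_integral (rectpath (a n) (b n)) (\<lambda>\<zeta>.
         (\<Prod>j=0..r. Gamma (\<sigma> + of_nat (\<nu> j))) / (\<Prod>j=0..q. Gamma (\<zeta> + of_nat (\<nu> j))) *
         (Gamma (\<zeta> - of_nat n + 1) / Gamma (\<sigma> - of_nat n + 1)) *
         (of_real (x / real n) powr \<zeta> * of_real (y / real n) powr (- \<sigma> - 1) / (\<sigma> - \<zeta>)))
       / (2 * of_real pi * \<i>)) = S_sigma_integral c \<delta> (\<lambda>\<sigma>. of_nat n * ginibre_integrand \<nu> q r n x y \<sigma>)"
      using ginibre_inner_integral[of \<nu> n c "a n" "b n"] assms c n pos by (intro S_sigma_integral_cong) auto
    ultimately show ?thesis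
      using n unfolding ginibre_kernel_def S_sigma_integral_mult_left by (simp add: algebra_simps)
  qed
  have hard: "hard_edge_kernel \<kappa> c \<delta> c' \<nu> q x r y =
      kernel_transition \<kappa> \<nu> q x r y + S_sigma_integral c \<delta> (hard_edge_integrand \<nu> q r x y) / (2 * of_real pi * \<i>)"
    if "x \<in> X" for x y
  proof -
    have "x > 0" using that assms by auto
    then have "S_sigma_integral c \<delta> (\<lambda>\<sigma>.
       S_zeta_integral c' \<delta> (\<lambda>\<zeta>.
         (\<Prod>j=1..r. Gamma (\<sigma> + of_nat (\<nu> j))) / (\<Prod>j=1..q. Gamma (\<zeta> + of_nat (\<nu> j))) *
         (Gamma (- \<zeta>) / Gamma (- \<sigma>)) *
         (of_real x powr \<zeta> * of_real y powr (- \<sigma> - 1) / (\<sigma> - \<zeta>)))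
       / (2 * of_real pi * \<i>)) = S_sigma_integral c \<delta> (hard_edge_integrand \<nu> q r x y)"
      using assms c by (intro S_sigma_integral_cong hard_edge_inner_integral) auto
    then show ?thesis by (simp add: hard_edge_kernel_def)
  qed
  have "uniform_limit (X \<times> Y) (\<lambda>n (x, y). S_sigma_integral c \<delta> (ginibre_integrand \<nu> q r n x y))
      (\<lambda>(x, y). S_sigma_integral c \<delta> (hard_edge_integrand \<nu> q r x y)) sequentially"
    by (rule S_sigma_integral_uniform_limit[OF _ \<open>r \<ge> 1\<close> c \<open>c < 1\<close> \<open>0 < \<delta>\<close> A Y m A']) (rule assms(2))
  then have "uniform_limit (X \<times> Y)
      (\<lambda>n p. T p + (case p of (x, y) \<Rightarrow> S_sigma_integral c \<delta> (ginibre_integrand \<nu> q r n x y)) * (1 / (2 * of_real pi * \<i>)))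
      (\<lambda>p. T p + (case p of (x, y) \<Rightarrow> S_sigma_integral c \<delta> (hard_edge_integrand \<nu> q r x y)) * (1 / (2 * of_real pi * \<i>)))
      sequentially"
    by (intro uniform_limit_add uniform_limit_const bounded_linear.uniform_limit[OF bounded_linear_mult_left])
  then show ?thesis
  proof (rule uniform_limit_cong[THEN iffD1, rotated 2])
    show "\<forall>\<^sub>F n in sequentially. \<forall>p\<in>X \<times> Y.
        T p + (case p of (x, y) \<Rightarrow> S_sigma_integral c \<delta> (ginibre_integrand \<nu> q r n x y)) * (1 / (2 * of_real pi * \<i>)) =
        (case p of (x, y) \<Rightarrow> 1 / of_nat n *
          ginibre_kernel \<kappa> c \<delta> (a n) (b n) n \<nu> q (x / real n) r (y / real n))"
      using eventually_ge_at_top[of 1]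
    proof eventually_elim
      case (elim n)
      show ?case by (clarify, subst ginibre[OF elim]) (simp_all add: T_def)
    qed
    show "T p + (case p of (x, y) \<Rightarrow> S_sigma_integral c \<delta> (hard_edge_integrand \<nu> q r x y)) * (1 / (2 * of_real pi * \<i>)) =
        (case p of (x, y) \<Rightarrow> hard_edge_kernel \<kappa> c \<delta> c' \<nu> q x r y)" if "p \<in> X \<times> Y" for p
      using that by (clarify, subst hard) (simp_all add: T_def)
  qed
qed

end
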